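(* Let $G \in \mathscr{L}$ be a strongly topological gyrogroup and let $N$ be a closed strong subgyrogroup of $G$. If the quotient space $G/N$ is locally compact, then the inequality $w(G/N)\le \mathfrak{c}$ holds if and only if $G/N$ is separable.
   Context: All topological spaces are assumed to be Hausdorff. $\mathscr{L}$ denotes a class of Lindelöf spaces that is closed under finite products (so if $X,Y\in\mathscr{L}$ then $X\times Y\in\mathscr{L}$; in particular, all finite powers of a member of $\mathscr{L}$ are Lindelöf). The weight $w(X)$ of a space $X$ is the smallest cardinality of a base of the topology of $X$, and $\mathfrak{c}=2^{\aleph_0}$. A gyrogroup is a set $G$ with a binary operation $\oplus$ such that: (G1) there is a unique identity element $0\in G$ with $0\oplus a=a=a\oplus 0$ for all $a\in G$; (G2) for each $x\in G$ there is a unique inverse $\ominus x\in G$ with $\ominus x\oplus x=0=x\oplus(\ominus x)$; (G3) for all $x,y\in G$ there is an automorphism $\mathrm{gyr}[x,y]\in \mathrm{Aut}(G,\oplus)$ with $x\oplus(y\oplus z)=(x\oplus y)\oplus \mathrm{gyr}[x,y](z)$ for all $z\in G$; (G4) $\mathrm{gyr}[x\oplus y,y]=\mathrm{gyr}[x,y]$ for all $x,y\in G$. A topological gyrogroup is a gyrogroup $G$ with a topology such that $\oplus:G\times G\to G$ is (jointly) continuous and $x\mapsto\ominus x$ is continuous. A topological gyrogroup $G$ is a strongly topological gyrogroup if there is a neighborhood base $\mathscr{U}$ at $0$ such that $\mathrm{gyr}[x,y](U)=U$ for all $U\in\mathscr{U}$ and all $x,y\in G$ (one may assume each $U\in\mathscr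 U$ is symmetric, $\ominus U=U$). A nonempty subset $N\subseteq G$ is a subgyrogroup if $\oplus$ restricts to a binary operation on $N$, $N$ is a gyrogroup under it, and for all $x,y\in N$ the restriction $\mathrm{gyr}[x,y]|_N:N\to\mathrm{gyr}[x,y](N)$ is a bijective homomorphism. A subgyrogroup $N$ is a strong subgyrogroup if $\mathrm{gyr}[x,y](N)=N$ for all $x,y\in G$. In that case the left cosets $a\oplus N$, $a\in G$, form a partition of $G$, and $G/N$ denotes the set of left cosets with the quotient topology induced by the map $G\to G/N$, $a\mapsto a\oplus N$. *)

theory Defs
  imports "HOL-Analysis.Analysis"
begin

section \<open>Gyrogroups\<close>

text \<open>Functions are total in HOL, so an automorphism is constrained only on the carrier; in
  particular equality of gyrations is equality on the carrier.\<close>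

definition is_automorphism :: "'a set \<Rightarrow> ('a \<Rightarrow> 'a \<Rightarrow> 'a) \<Rightarrow> ('a \<Rightarrow> 'a) \<Rightarrow> bool" where
  "is_automorphism G f \<phi> \<longleftrightarrow>
     bij_betw \<phi> G G \<and> (\<forall>x\<in>G. \<forall>y\<in>G. \<phi> (f x y) = f (\<phi> x) (\<phi> y))"

text \<open>The identity, the inversion and the gyrations are parameters of the locale. On the carrier
  they are uniquely determined by the operation.\<close>

locale gyrogroup =
  fixes G :: "'a set"
    and gplus :: "'a \<Rightarrow> 'a \<Rightarrow> 'a" (infixl "\<oplus>" 65)
    and gzero :: 'a ("\<zero>")
    and gminus :: "'a \<Rightarrow> 'a"
    and gyr :: "'a \<Rightarrow> 'a \<Rightarrow> 'a \<Rightarrow> 'a"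
  assumes gplus_closed: "x \<in> G \<Longrightarrow> y \<in> G \<Longrightarrow> x \<oplus> y \<in> G"
    and gzero_closed: "\<zero> \<in> G"
    and gzero_left: "a \<in> G \<Longrightarrow> \<zero> \<oplus> a = a"
    and gzero_right: "a \<in> G \<Longrightarrow> a \<oplus> \<zero> = a"
    and gzero_unique:
      "e \<in> G \<Longrightarrow> (\<And>a. a \<in> G \<Longrightarrow> e \<oplus> a = a \<and> a \<oplus> e = a) \<Longrightarrow> e = \<zero>"
    and gminus_closed: "x \<in> G \<Longrightarrow> gminus x \<in> G"
    and gminus_left: "x \<in> G \<Longrightarrow> gminus x \<oplus> x = \<zero>"
    and gminus_right: "x \<in> G \<Longrightarrow> x \<oplus> gminus x = \<zero>"
    and gminus_unique:
      "x \<in> G \<Longrightarrow> y \<in> G \<Longrightarrow> y \<oplus> x = \<zero> \<Longrightarrow> x \<oplus> y = \<zero> \<Longrightarrow> y = gminus x"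
    and gyr_automorphism: "x \<in> G \<Longrightarrow> y \<in> G \<Longrightarrow> is_automorphism G (\<oplus>) (gyr x y)"
    and gyr_assoc:
      "x \<in> G \<Longrightarrow> y \<in> G \<Longrightarrow> z \<in> G \<Longrightarrow> x \<oplus> (y \<oplus> z) = (x \<oplus> y) \<oplus> gyr x y z"
    and gyr_loop: "x \<in> G \<Longrightarrow> y \<in> G \<Longrightarrow> z \<in> G \<Longrightarrow> gyr (x \<oplus> y) y z = gyr x y z"

definition subgyrogroup ::
    "'a set \<Rightarrow> ('a \<Rightarrow> 'a \<Rightarrow> 'a) \<Rightarrow> ('a \<Rightarrow> 'a \<Rightarrow> 'a \<Rightarrow> 'a) \<Rightarrow> 'a set \<Rightarrow> bool" where
  "subgyrogroup G f gyr N \<longleftrightarrow>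
     N \<noteq> {} \<and> N \<subseteq> G \<and> (\<forall>x\<in>N. \<forall>y\<in>N. f x y \<in> N) \<and>
     (\<exists>e i g. gyrogroup N f e i g) \<and>
     (\<forall>x\<in>N. \<forall>y\<in>N. bij_betw (gyr x y) N (gyr x y ` N) \<and>
        (\<forall>a\<in>N. \<forall>b\<in>N. gyr x y (f a b) = f (gyr x y a) (gyr x y b)))"

definition strong_subgyrogroup ::
    "'a set \<Rightarrow> ('a \<Rightarrow> 'a \<Rightarrow> 'a) \<Rightarrow> ('a \<Rightarrow> 'a \<Rightarrow> 'a \<Rightarrow> 'a) \<Rightarrow> 'a set \<Rightarrow> bool" where
  "strong_subgyrogroup G f gyr N \<longleftrightarrow>
     subgyrogroup G f gyr N \<and> (\<forall>x\<in>G. \<forall>y\<in>G. gyr x y ` N = N)"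

section \<open>Topological gyrogroups\<close>

text \<open>The carrier is the underlying set of the topology; as a standing convention all spaces
  are Hausdorff.\<close>

locale topological_gyrogroup = gyrogroup "topspace T" gplus gzero gminus gyr
  for T :: "'a topology"
    and gplus :: "'a \<Rightarrow> 'a \<Rightarrow> 'a" (infixl "\<oplus>" 65)
    and gzero :: 'a ("\<zero>")
    and gminus :: "'a \<Rightarrow> 'a"
    and gyr :: "'a \<Rightarrow> 'a \<Rightarrow> 'a \<Rightarrow> 'a" +
  assumes Hausdorff: "Hausdorff_space T"
    and continuous_gplus: "continuous_map (prod_topology T T) T (\<lambda>(x, y). x \<oplus> y)"
    and continuous_gminus: "continuous_map T T gminus"

definition is_neighborhood_base :: "'a topology \<Rightarrow> 'a \<Rightarrow> 'a set set \<Rightarrow> bool" where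
  "is_neighborhood_base T x \<U> \<longleftrightarrow>
     (\<forall>U\<in>\<U>. U \<subseteq> topspace T \<and> x \<in> T interior_of U) \<and>
     (\<forall>W. openin T W \<and> x \<in> W \<longrightarrow> (\<exists>U\<in>\<U>. U \<subseteq> W))"

locale strongly_topological_gyrogroup = topological_gyrogroup +
  assumes gyr_invariant_base:
    "\<exists>\<U>. is_neighborhood_base T \<zero> \<U> \<and>
       (\<forall>U\<in>\<U>. \<forall>x\<in>topspace T. \<forall>y\<in>topspace T. gyr x y ` U = U)"

section \<open>Coset spaces\<close>

definition quotient_topology :: "'a topology \<Rightarrow> ('a \<Rightarrow> 'b) \<Rightarrow> 'b topology" where
  "quotient_topology X q =
     topology (\<lambda>U. U \<subseteq> q ` topspace X \<and> openin X {x \<in> topspace X. q x \<in> U})"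

lemma openin_quotient_topology:
  "openin (quotient_topology X q) U \<longleftrightarrow>
     U \<subseteq> q ` topspace X \<and> openin X {x \<in> topspace X. q x \<in> U}"
proof -
  have "istopology (\<lambda>U. U \<subseteq> q ` topspace X \<and> openin X {x \<in> topspace X. q x \<in> U})"
    unfolding istopology_def
  proof (intro conjI allI impI)
    fix S U
    assume "S \<subseteq> q ` topspace X \<and> openin X {x \<in> topspace X. q x \<in> S}"
      and "U \<subseteq> q ` topspace X \<and> openin X {x \<in> topspace X. q x \<in> U}"
    moreover have "{x \<in> topspace X. q x \<in> S \<inter> U} =
        {x \<in> topspace X. q x \<in> S} \<inter> {x \<in> topspace X. q x \<in> U}"
      by auto
    ultimately show "S \<inter> U \<subseteq> q ` topspace X"
      and "openin X {x \<in> topspace X. q x \<in> S \<inter> U}"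
      by auto
  next
    fix \<K>
    assume *: "\<forall>K\<in>\<K>. K \<subseteq> q ` topspace X \<and> openin X {x \<in> topspace X. q x \<in> K}"
    then show "\<Union>\<K> \<subseteq> q ` topspace X"
      by blast
    have "{x \<in> topspace X. q x \<in> \<Union>\<K>} = (\<Union>K\<in>\<K>. {x \<in> topspace X. q x \<in> K})"
      by auto
    then show "openin X {x \<in> topspace X. q x \<in> \<Union>\<K>}"
      using * by auto
  qed
  then show ?thesis
    by (simp add: quotient_topology_def)
qed

lemma topspace_quotient_topology: "topspace (quotient_topology X q) = q ` topspace X"
proof -
  have "{x \<in> topspace X. q x \<in> q ` topspace X} = topspace X"
    by auto
  then have "openin (quotient_topology X q) (q ` topspace X)"
    by (simp add: openin_quotient_topology)
  then show ?thesis
    by (meson openin_quotient_topology openin_subset openin_topspace subset_antisym)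
qed

lemma quotient_map_quotient_topology: "quotient_map X (quotient_topology X q) q"
  by (auto simp: quotient_map_def topspace_quotient_topology openin_quotient_topology)

definition coset_space :: "'a topology \<Rightarrow> ('a \<Rightarrow> 'a \<Rightarrow> 'a) \<Rightarrow> 'a set \<Rightarrow> 'a set topology" where
  "coset_space T f N = quotient_topology T (\<lambda>a. f a ` N)"

section \<open>Weight\<close>

definition is_base :: "'a topology \<Rightarrow> 'a set set \<Rightarrow> bool" where
  "is_base X \<B> \<longleftrightarrow> openin X = arbitrary union_of (\<lambda>U. U \<in> \<B>)"

text \<open>Cardinals are represented by the cardinal orders of HOL, and are compared by \<open>\<le>o\<close>.
  Since cardinal orders are only determined up to \<open>=o\<close>, a representative is chosen.\<close>

definition weight :: "'a topology \<Rightarrow> 'a set rel" where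
  "weight X = (SOME r. \<exists>\<B>. is_base X \<B> \<and> r = card_of \<B> \<and>
                  (\<forall>\<C>. is_base X \<C> \<longrightarrow> (card_of \<B>, card_of \<C>) \<in> ordLeq))"

lemma weight_minimal_base:
  "\<exists>\<B>. is_base X \<B> \<and> weight X = card_of \<B> \<and>
       (\<forall>\<C>. is_base X \<C> \<longrightarrow> (card_of \<B>, card_of \<C>) \<in> ordLeq)"
proof -
  have "is_base X {U. openin X U}"
    unfolding is_base_def openin_topology_base_unique by auto
  then have "card_of ` {\<B>. is_base X \<B>} \<noteq> {}"
    by auto
  moreover have "\<forall>r \<in> card_of ` {\<B>. is_base X \<B>}. Card_order r"
    by (auto simp: card_of_Card_order)
  ultimately have "\<exists>r \<in> card_of ` {\<B>. is_base X \<B>}.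
      \<forall>r' \<in> card_of ` {\<B>. is_base X \<B>}. (r, r') \<in> ordLeq"
    by (rule exists_minim_Card_order)
  then have "\<exists>r \<B>. is_base X \<B> \<and> r = card_of \<B> \<and>
      (\<forall>\<C>. is_base X \<C> \<longrightarrow> (card_of \<B>, card_of \<C>) \<in> ordLeq)"
    by auto
  then show ?thesis
    unfolding weight_def by (rule someI_ex)
qed

lemma weight_ordLeq_iff:
  "(weight X, r) \<in> ordLeq \<longleftrightarrow> (\<exists>\<B>. is_base X \<B> \<and> (card_of \<B>, r) \<in> ordLeq)"
  using weight_minimal_base[of X] by (metis ordLeq_transitive)

definition continuum :: "(nat \<Rightarrow> bool) rel" where
  "continuum = card_of (UNIV :: (nat \<Rightarrow> bool) set)"

section \<open>Productive classes of Lindelof spaces\<close>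

text \<open>A HOL type cannot contain spaces over all types, so a class is a set of topologies (with
  arbitrary underlying sets) on one arbitrary type; a product of two members lives on the product
  type and is required to belong to the class up to homeomorphism. This is no restriction:
  given a class and a member of it, choose an infinite type that is at least as large as that member
  and take all copies in that type of members of the class.\<close>

definition productive_Lindelof_class :: "'a topology set \<Rightarrow> bool" where
  "productive_Lindelof_class \<L> \<longleftrightarrow>
     (\<forall>X\<in>\<L>. Hausdorff_space X \<and> Lindelof_space X) \<and>
     (\<forall>X\<in>\<L>. \<forall>Y\<in>\<L>. \<exists>Z\<in>\<L>. Z homeomorphic_space prod_topology X Y)"

end

theory Submission
  imports Defs
begin

text \<open>If \<open>G/N\<close> is separable then, being regular, it has at most \<open>2\<^sup>\<omega>\<close> regular open sets.
  Conversely, a weight of at most the continuum yields closed strong subgyrogroups \<open>M\<^sub>t \<supseteq> N\<close>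
  (\<open>t \<in> 2\<^sup>\<omega>\<close>) with intersection \<open>N\<close> such that \<open>M\<^sub>t/N\<close> is compact and \<open>G/M\<^sub>t\<close> is second
  countable; the Lindelof property lets one close off a countable family of neighbourhoods of
  \<open>\<zero>\<close> so that its intersection modulo \<open>N\<close> is such a subgyrogroup. Well-order the indices. Every
  \<open>z : 2\<^sup>\<omega> \<rightarrow> \<nat>\<close> guides a transfinite choice of a point of \<open>G/N\<close>: at stage \<open>t\<close> the coset of the
  intersection of the earlier \<open>M\<^sub>s\<close> is refined to a coset that meets the basic open set number
  \<open>z t\<close> of \<open>G/M\<^sub>t\<close> whenever possible, and compactness carries the construction through limit
  stages. All quotient maps between coset spaces are open, so by induction every nonempty open
  subset of \<open>G/N\<close> contains all points whose guide agrees with a suitable one on a suitable finite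
  set of indices. As \<open>\<nat>\<close> to the power \<open>2\<^sup>\<omega>\<close> is separable, so is \<open>G/N\<close>.\<close>

section \<open>Gyrogroup identities\<close>

context gyrogroup
begin

lemma gyr_bij: "x \<in> G \<Longrightarrow> y \<in> G \<Longrightarrow> bij_betw (gyr x y) G G"
  using gyr_automorphism by (auto simp: is_automorphism_def)

lemma gyr_closed: "x \<in> G \<Longrightarrow> y \<in> G \<Longrightarrow> z \<in> G \<Longrightarrow> gyr x y z \<in> G"
  using gyr_bij bij_betwE by blast

lemma gyr_inj: "\<lbrakk>x \<in> G; y \<in> G; a \<in> G; b \<in> G; gyr x y a = gyr x y b\<rbrakk> \<Longrightarrow> a = b"
  using gyr_bij by (meson bij_betw_imp_inj_on inj_onD)

lemma gyr_add: "\<lbrakk>x \<in> G; y \<in> G; a \<in> G; b \<in> G\<rbrakk> \<Longrightarrow> gyr x y (a \<oplus> b) = gyr x y a \<oplus> gyr x y b"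
  using gyr_automorphism by (auto simp: is_automorphism_def)

text \<open>Adding \<open>gminus x\<close> on the left turns both sides into values of the one
  gyration \<open>gyr (gminus x) x\<close>, which is injective.\<close>

lemma left_cancel_iff:
  assumes "x \<in> G" "a \<in> G" "b \<in> G"
  shows "x \<oplus> a = x \<oplus> b \<longleftrightarrow> a = b"
proof
  assume "x \<oplus> a = x \<oplus> b"
  then have "(gminus x \<oplus> x) \<oplus> gyr (gminus x) x a = (gminus x \<oplus> x) \<oplus> gyr (gminus x) x b"
    using assms by (metis gminus_closed gyr_assoc)
  then show "a = b"
    using assms gyr_inj[of "gminus x" x a b]
    by (simp add: gminus_left gminus_closed gyr_closed gzero_left)
qed auto

lemma gyr_zero_left: "x \<in> G \<Longrightarrow> y \<in> G \<Longrightarrow> gyr \<zero> x y = y"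
  using gyr_assoc[of "\<zero>" x y] left_cancel_iff[of x "gyr \<zero> x y" y]
  by (simp add: gzero_closed gzero_left gplus_closed gyr_closed)

lemma gyr_self: "x \<in> G \<Longrightarrow> y \<in> G \<Longrightarrow> gyr x x y = y"
  using gyr_loop[of "\<zero>" x y] by (simp add: gzero_closed gzero_left gyr_zero_left)

text \<open>The gyration in the way, \<open>gyr (gminus x) x\<close>, is trivial: the loop property
  identifies it with a gyration whose first argument is \<open>\<zero>\<close>.\<close>

lemma minus_add_cancel: "x \<in> G \<Longrightarrow> y \<in> G \<Longrightarrow> gminus x \<oplus> (x \<oplus> y) = y"
  using gyr_assoc[of "gminus x" x y] gyr_loop[of "gminus x" x y]
  by (simp add: gminus_closed gminus_left gyr_zero_left gzero_left gyr_closed)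

lemma minus_minus: "x \<in> G \<Longrightarrow> gminus (gminus x) = x"
  using gminus_unique[of "gminus x" x] by (simp add: gminus_closed gminus_left gminus_right)

lemma add_minus_cancel: "x \<in> G \<Longrightarrow> y \<in> G \<Longrightarrow> x \<oplus> (gminus x \<oplus> y) = y"
  using minus_add_cancel[of "gminus x" y] by (simp add: gminus_closed minus_minus)

lemma minus_unique_right: "\<lbrakk>x \<in> G; y \<in> G; x \<oplus> y = \<zero>\<rbrakk> \<Longrightarrow> y = gminus x"
  using minus_add_cancel[of x y] by (simp add: gminus_closed gzero_right)

lemma minus_zero: "gminus \<zero> = \<zero>"
  using minus_unique_right[of "\<zero>" "\<zero>"] by (simp add: gzero_closed gzero_left)

lemma gyr_zero: "x \<in> G \<Longrightarrow> y \<in> G \<Longrightarrow> gyr x y \<zero> = \<zero>"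
  using gyr_assoc[of x y "\<zero>"] left_cancel_iff[of "x \<oplus> y" "gyr x y \<zero>" "\<zero>"]
  by (simp add: gzero_closed gzero_right gplus_closed gyr_closed)

lemma gyr_minus: "\<lbrakk>x \<in> G; y \<in> G; a \<in> G\<rbrakk> \<Longrightarrow> gyr x y (gminus a) = gminus (gyr x y a)"
  by (metis gyr_add gyr_closed gyr_zero gminus_closed gminus_right minus_unique_right)

text \<open>Gyrations are expressions in the operation and the inverse. In a topological gyrogroup
  this yields their continuity.\<close>

lemma gyr_eq:
  "\<lbrakk>x \<in> G; y \<in> G; z \<in> G\<rbrakk> \<Longrightarrow> gyr x y z = gminus (x \<oplus> y) \<oplus> (x \<oplus> (y \<oplus> z))"
  by (simp add: gyr_assoc gplus_closed gyr_closed minus_add_cancel)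

text \<open>The argument undoes the three left translations of \<open>gyr_eq\<close> one after the
  other, so the inverse of a gyration is again built from continuous operations.\<close>

lemma gyr_inverse:
  assumes "x \<in> G" "y \<in> G" "w \<in> G"
  shows "gyr x y (gminus y \<oplus> (gminus x \<oplus> ((x \<oplus> y) \<oplus> w))) = w"
  using assms by (simp add: gyr_eq gplus_closed gminus_closed add_minus_cancel minus_add_cancel)

text \<open>The summand that undoes \<open>h\<close> is a gyration of \<open>gminus h\<close>. It
  therefore stays inside every symmetric gyration-invariant set that contains
  \<open>h\<close>.\<close>

lemma right_cancel: "x \<in> G \<Longrightarrow> h \<in> G \<Longrightarrow> (x \<oplus> h) \<oplus> gyr x h (gminus h) = x"
  using gyr_assoc[of x h "gminus h"] by (simp add: gminus_closed gminus_right gzero_right)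

text \<open>Since \<open>L\<^sub>x L\<^sub>y = L\<^bsub>x\<oplus>y\<^esub> gyr[x,y]\<close> for left translations, the loop property of
  gyrations is the left Bol identity; it provides explicit right division.\<close>

lemma left_Bol:
  assumes "z \<in> G" "u \<in> G" "w \<in> G"
  shows "(z \<oplus> (u \<oplus> z)) \<oplus> w = z \<oplus> (u \<oplus> (z \<oplus> w))"
proof -
  \<comment> \<open>The pair \<open>gminus u\<close>, \<open>u \<oplus> z\<close> has sum
    \<open>z\<close>, so the loop property equates \<open>gyr z y\<close> with
    \<open>gyr x y\<close>. Comparing the two instances of \<open>gyr_eq\<close> at
    \<open>gminus y \<oplus> v\<close> gives the identity.\<close>
  define x where "x = gminus u"
  have x: "x \<in> G" "gminus x = u"
    using assms by (auto simp: x_def gminus_closed minus_minus)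
  define y where "y = u \<oplus> z"
  have y: "y \<in> G" "x \<oplus> y = z"
    using assms x add_minus_cancel[of x z] by (auto simp: y_def gplus_closed)
  define v where "v = u \<oplus> (z \<oplus> w)"
  have v: "v \<in> G" and cl: "gminus y \<oplus> v \<in> G"
    using assms y by (auto simp: v_def gplus_closed gminus_closed)
  have "gyr z y (gminus y \<oplus> v) = gyr x y (gminus y \<oplus> v)"
    using gyr_loop[of x y "gminus y \<oplus> v"] x y cl by simp
  then have "gminus (z \<oplus> y) \<oplus> (z \<oplus> v) = gminus z \<oplus> (x \<oplus> v)"
    using gyr_eq[of z y "gminus y \<oplus> v"] gyr_eq[of x y "gminus y \<oplus> v"] x y v assms cl
    by (simp add: add_minus_cancel)
  also have "\<dots> = w"
    using assms by (simp add: x_def v_def minus_add_cancel gplus_closed)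
  finally have "(z \<oplus> y) \<oplus> w = z \<oplus> v"
    using add_minus_cancel[of "z \<oplus> y" "z \<oplus> v"] assms y v by (simp add: gplus_closed)
  then show ?thesis
    by (simp add: y_def v_def)
qed

text \<open>This is the first factor in the left Bol identity for \<open>z = gminus p\<close> and
  \<open>u = p \<oplus> b\<close>. Unlike a solution of \<open>u \<oplus> p = b\<close> obtained by
  choice, the formula is visibly continuous in both arguments.\<close>

definition rdiv :: "'a \<Rightarrow> 'a \<Rightarrow> 'a" where
  "rdiv b p = gminus p \<oplus> ((p \<oplus> b) \<oplus> gminus p)"

lemma rdiv_add: "b \<in> G \<Longrightarrow> p \<in> G \<Longrightarrow> rdiv b p \<oplus> p = b"
  using left_Bol[of "gminus p" "p \<oplus> b" p]
  by (simp add: rdiv_def gplus_closed gminus_closed gminus_left gzero_right minus_add_cancel)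

lemma rdiv_self: "p \<in> G \<Longrightarrow> rdiv p p = \<zero>"
  using gyr_assoc[of p p "gminus p"]
  by (simp add: rdiv_def gminus_closed gminus_left gminus_right gzero_right gyr_self)

section \<open>Sums of sets and gyration-invariant sets\<close>

definition set_gplus :: "'a set \<Rightarrow> 'a set \<Rightarrow> 'a set" (infixl "\<boxplus>" 65) where
  "A \<boxplus> B = {a \<oplus> b | a b. a \<in> A \<and> b \<in> B}"

lemma set_gplus_mono: "A \<subseteq> A' \<Longrightarrow> B \<subseteq> B' \<Longrightarrow> A \<boxplus> B \<subseteq> A' \<boxplus> B'"
  by (auto simp: set_gplus_def)

lemma set_gplus_closed: "A \<subseteq> G \<Longrightarrow> B \<subseteq> G \<Longrightarrow> A \<boxplus> B \<subseteq> G"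
  by (auto simp: set_gplus_def subset_iff intro!: gplus_closed)

lemma subset_set_gplus: "A \<subseteq> G \<Longrightarrow> \<zero> \<in> B \<Longrightarrow> A \<subseteq> A \<boxplus> B"
  unfolding set_gplus_def
  by (rule subsetI, rule CollectI, intro exI conjI) (auto simp: gzero_right subset_iff)

lemma subset_set_gplus_left: "B \<subseteq> G \<Longrightarrow> \<zero> \<in> A \<Longrightarrow> B \<subseteq> A \<boxplus> B"
  unfolding set_gplus_def
  by (rule subsetI, rule CollectI, intro exI conjI) (auto simp: gzero_left subset_iff)

definition gyr_invariant :: "'a set \<Rightarrow> bool" where
  "gyr_invariant A \<longleftrightarrow> A \<subseteq> G \<and> (\<forall>x\<in>G. \<forall>y\<in>G. gyr x y ` A = A)"

lemma gyr_invariantD: "\<lbrakk>gyr_invariant A; x \<in> G; y \<in> G; a \<in> A\<rbrakk> \<Longrightarrow> gyr x y a \<in> A"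
  unfolding gyr_invariant_def by blast

text \<open>A gyration-invariant set absorbs the gyration, so brackets may be moved at the price of
  exchanging one element of \<open>A\<close> for another. This replaces associativity from here
  on.\<close>

lemma gyr_invariant_assoc_left:
  assumes "gyr_invariant A" "x \<in> G" "y \<in> G" "a \<in> A"
  obtains a' where "a' \<in> A" "(x \<oplus> y) \<oplus> a = x \<oplus> (y \<oplus> a')"
proof -
  have "a \<in> gyr x y ` A"
    using assms by (simp add: gyr_invariant_def)
  then obtain a' where "a' \<in> A" "a = gyr x y a'"
    by blast
  then show thesis
    using that assms gyr_assoc[of x y a'] by (metis gyr_invariant_def subsetD)
qed

lemma gyr_invariant_assoc_right:
  assumes "gyr_invariant A" "x \<in> G" "y \<in> G" "a \<in> A"
  obtains a' where "a' \<in> A" "x \<oplus> (y \<oplus> a) = (x \<oplus> y) \<oplus> a'"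
  using that assms gyr_assoc[of x y a] by (metis gyr_invariant_def gyr_invariantD subsetD)

lemma set_gplus_assoc_subset:
  assumes "A \<subseteq> G" "B \<subseteq> G" "gyr_invariant C"
  shows "A \<boxplus> (B \<boxplus> C) \<subseteq> (A \<boxplus> B) \<boxplus> C"
proof
  fix x assume "x \<in> A \<boxplus> (B \<boxplus> C)"
  then obtain a b c where *: "a \<in> A" "b \<in> B" "c \<in> C" "x = a \<oplus> (b \<oplus> c)"
    by (auto simp: set_gplus_def)
  then obtain c' where "c' \<in> C" "x = (a \<oplus> b) \<oplus> c'"
    using gyr_invariant_assoc_right assms by blast
  then show "x \<in> (A \<boxplus> B) \<boxplus> C"
    using * by (auto simp: set_gplus_def)
qed

lemma gyr_invariant_set_gplus:
  assumes "gyr_invariant A" "gyr_invariant B"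
  shows "gyr_invariant (A \<boxplus> B)"
  unfolding gyr_invariant_def
proof (intro conjI ballI)
  show "A \<boxplus> B \<subseteq> G"
    using assms by (simp add: set_gplus_closed gyr_invariant_def)
  fix x y assume xy: "x \<in> G" "y \<in> G"
  have add: "gyr x y (a \<oplus> b) = gyr x y a \<oplus> gyr x y b" if "a \<in> A" "b \<in> B" for a b
    using that assms xy by (meson gyr_add gyr_invariant_def subsetD)
  have im: "gyr x y ` A = A" "gyr x y ` B = B"
    using assms xy by (auto simp: gyr_invariant_def)
  show "gyr x y ` (A \<boxplus> B) = A \<boxplus> B"
  proof
    show "gyr x y ` (A \<boxplus> B) \<subseteq> A \<boxplus> B"
      using add im by (force simp: set_gplus_def)
    show "A \<boxplus> B \<subseteq> gyr x y ` (A \<boxplus> B)"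
    proof
      fix z assume "z \<in> A \<boxplus> B"
      then obtain a b where "a \<in> gyr x y ` A" "b \<in> gyr x y ` B" "z = a \<oplus> b"
        by (auto simp: set_gplus_def im)
      then obtain a' b' where "a' \<in> A" "b' \<in> B" "z = gyr x y (a' \<oplus> b')"
        using add by auto
      then show "z \<in> gyr x y ` (A \<boxplus> B)"
        by (auto simp: set_gplus_def)
    qed
  qed
qed

text \<open>Gyrations are injective on \<open>G\<close>, so their images commute with the
  intersection.\<close>

lemma gyr_invariant_Inter:
  assumes "\<A> \<noteq> {}" "\<And>A. A \<in> \<A> \<Longrightarrow> gyr_invariant A"
  shows "gyr_invariant (\<Inter>\<A>)"
  unfolding gyr_invariant_def
proof (intro conjI ballI)
  show "\<Inter>\<A> \<subseteq> G"
    using assms by (auto simp: gyr_invariant_def)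
  fix x y assume xy: "x \<in> G" "y \<in> G"
  have "gyr x y ` \<Inter>\<A> = (\<Inter>A\<in>\<A>. gyr x y ` A)"
  proof -
    obtain A0 where "A0 \<in> \<A>"
      using assms(1) by blast
    moreover have "\<forall>A\<in>\<A>. A \<subseteq> G"
      using assms(2) by (auto simp: gyr_invariant_def)
    ultimately show ?thesis
      using image_INT[of "gyr x y" G \<A> "\<lambda>A. A" A0] bij_betw_imp_inj_on[OF gyr_bij[OF xy]] by simp
  qed
  also have "\<dots> = (\<Inter>A\<in>\<A>. A)"
    using assms(2) xy by (intro INF_cong) (auto simp: gyr_invariant_def)
  finally show "gyr x y ` \<Inter>\<A> = \<Inter>\<A>"
    by simp
qed

section \<open>Strong subgyrogroups and their left cosets\<close>

definition strong_sub :: "'a set \<Rightarrow> bool" where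
  "strong_sub H \<longleftrightarrow> gyr_invariant H \<and> \<zero> \<in> H \<and> (\<forall>x\<in>H. \<forall>y\<in>H. x \<oplus> y \<in> H) \<and>
     (\<forall>x\<in>H. gminus x \<in> H)"

text \<open>The subgyrogroup comes with its own identity and inverses. Its identity is idempotent,
  hence equal to \<open>\<zero>\<close> by cancellation, and then its inverses are right inverses in
  \<open>G\<close> and agree with \<open>gminus\<close>.\<close>

lemma strong_sub_if_strong_subgyrogroup:
  assumes "strong_subgyrogroup G (\<oplus>) gyr H"
  shows "strong_sub H"
proof -
  have H: "H \<noteq> {}" "H \<subseteq> G" "\<And>x y. x \<in> H \<Longrightarrow> y \<in> H \<Longrightarrow> x \<oplus> y \<in> H" "gyr_invariant H"
    using assms by (auto simp: strong_subgyrogroup_def subgyrogroup_def gyr_invariant_def)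
  obtain e i g where "gyrogroup H (\<oplus>) e i g"
    using assms by (auto simp: strong_subgyrogroup_def subgyrogroup_def)
  then interpret H: gyrogroup H "(\<oplus>)" e i g .
  have "e \<oplus> e = e \<oplus> \<zero>" "e \<in> G"
    using H.gzero_closed H.gzero_left[of e] gzero_right[of e] H(2) by auto
  then have e: "e = \<zero>"
    using left_cancel_iff[of e e "\<zero>"] gzero_closed by simp
  have "gminus x \<in> H" if "x \<in> H" for x
  proof -
    have "x \<oplus> i x = \<zero>" "i x \<in> H"
      using that H.gminus_right H.gminus_closed e by auto
    then show ?thesis
      using minus_unique_right[of x "i x"] that subsetD[OF H(2)] by simp
  qed
  then show ?thesis
    using H H.gzero_closed e by (auto simp: strong_sub_def)
qed

lemma strong_sub_invariant: "strong_sub H \<Longrightarrow> gyr_invariant H"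
  by (simp add: strong_sub_def)

lemma strong_sub_subset: "strong_sub H \<Longrightarrow> H \<subseteq> G"
  by (simp add: strong_sub_def gyr_invariant_def)

text \<open>In other words, \<open>A \<boxplus> H\<close> is a union of left cosets of
  \<open>H\<close>: invariance moves the brackets and \<open>H\<close> is closed under
  addition.\<close>

lemma strong_sub_absorb:
  assumes "strong_sub H" "A \<subseteq> G"
  shows "(A \<boxplus> H) \<boxplus> H \<subseteq> A \<boxplus> H"
proof
  fix x assume "x \<in> (A \<boxplus> H) \<boxplus> H"
  then obtain a h h1 where *: "a \<in> A" "h \<in> H" "h1 \<in> H" "x = (a \<oplus> h) \<oplus> h1"
    by (auto simp: set_gplus_def)
  moreover obtain h2 where "h2 \<in> H" "x = a \<oplus> (h \<oplus> h2)"
    using gyr_invariant_assoc_left[of H a h h1] * assms strong_sub_subset strong_sub_invariant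
    by (metis subsetD)
  moreover have "h \<oplus> h2 \<in> H" if "h2 \<in> H" for h2
    using that * assms by (simp add: strong_sub_def)
  ultimately show "x \<in> A \<boxplus> H"
    unfolding set_gplus_def by blast
qed

text \<open>The right side is a union of preimages under right translations, which are continuous.
  This is why \<open>A \<boxplus> H\<close> is open for open \<open>A\<close>, that is, why quotient
  maps onto coset spaces are open.\<close>

lemma set_gplus_strong_sub_eq:
  assumes "strong_sub H" "A \<subseteq> G"
  shows "A \<boxplus> H = (\<Union>h\<in>H. {g \<in> G. g \<oplus> h \<in> A})"
proof safe
  fix x assume "x \<in> A \<boxplus> H"
  then obtain a h where ah: "a \<in> A" "h \<in> H" "x = a \<oplus> h"
    by (auto simp: set_gplus_def)
  have G: "a \<in> G" "h \<in> G"
    using ah assms strong_sub_subset by auto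
  then have "x \<oplus> gyr a h (gminus h) = a" "gyr a h (gminus h) \<in> H" "x \<in> G"
    using ah assms by (auto simp: right_cancel gplus_closed strong_sub_def intro: gyr_invariantD)
  then show "x \<in> (\<Union>h\<in>H. {g \<in> G. g \<oplus> h \<in> A})"
    using ah by (intro UN_I[of "gyr a h (gminus h)"]) auto
next
  fix g h assume *: "h \<in> H" "g \<in> G" "g \<oplus> h \<in> A"
  have G: "h \<in> G"
    using * assms strong_sub_subset by auto
  have "(g \<oplus> h) \<oplus> gyr g h (gminus h) = g" "gyr g h (gminus h) \<in> H"
    using * G assms by (auto simp: right_cancel gplus_closed strong_sub_def intro: gyr_invariantD)
  then show "g \<in> A \<boxplus> H"
    using * unfolding set_gplus_def by (intro CollectI exI[of _ "g \<oplus> h"] exI) auto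
qed

lemma coset_iff:
  assumes "strong_sub H" "x \<in> G"
  shows "y \<in> (\<oplus>) x ` H \<longleftrightarrow> y \<in> G \<and> gminus x \<oplus> y \<in> H"
proof
  assume "y \<in> (\<oplus>) x ` H"
  then show "y \<in> G \<and> gminus x \<oplus> y \<in> H"
    using assms strong_sub_subset[of H] by (auto simp: minus_add_cancel gplus_closed subset_iff)
next
  assume "y \<in> G \<and> gminus x \<oplus> y \<in> H"
  then show "y \<in> (\<oplus>) x ` H"
    using assms by (metis add_minus_cancel image_eqI)
qed

lemma coset_absorb:
  assumes "strong_sub H" "x \<in> G" "y \<in> (\<oplus>) x ` H" "h \<in> H"
  shows "y \<oplus> h \<in> (\<oplus>) x ` H"
proof -
  obtain k where k: "k \<in> H" "y = x \<oplus> k" using assms by auto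
  moreover obtain h' where "h' \<in> H" "y \<oplus> h = x \<oplus> (k \<oplus> h')"
    using gyr_invariant_assoc_left[of H x k h] k assms strong_sub_subset strong_sub_invariant
    by (metis subsetD)
  ultimately show ?thesis
    using assms by (auto simp: strong_sub_def)
qed

lemma coset_sym:
  assumes "strong_sub H" "x \<in> G" "y \<in> (\<oplus>) x ` H"
  shows "x \<in> (\<oplus>) y ` H"
proof -
  obtain k where k: "k \<in> H" "y = x \<oplus> k" "k \<in> G"
    using assms strong_sub_subset by auto
  then have "y \<oplus> gyr x k (gminus k) = x" "gyr x k (gminus k) \<in> H"
    using assms by (auto simp: right_cancel strong_sub_def intro: gyr_invariantD)
  then show ?thesis
    by (metis image_eqI)
qed

lemma coset_eq:
  assumes "strong_sub H" "x \<in> G" "y \<in> (\<oplus>) x ` H"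
  shows "(\<oplus>) y ` H = (\<oplus>) x ` H"
proof -
  have "y \<in> G"
    using coset_iff assms by blast
  have "(\<oplus>) y ` H \<subseteq> (\<oplus>) x ` H"
    using coset_absorb[OF assms] by blast
  moreover have "(\<oplus>) x ` H \<subseteq> (\<oplus>) y ` H"
    using coset_absorb[OF assms(1) \<open>y \<in> G\<close> coset_sym[OF assms]] by blast
  ultimately show ?thesis
    by blast
qed

lemma self_in_coset: "strong_sub H \<Longrightarrow> x \<in> G \<Longrightarrow> x \<in> (\<oplus>) x ` H"
  using gzero_right by (force simp: strong_sub_def)


end

section \<open>Countable selection in Lindelof spaces and countable closure\<close>

text \<open>A witness that works on a neighbourhood of each point can be replaced by countably many
  witnesses: pass to a countable subcover and enumerate it.\<close>

lemma Lindelof_space_sequence: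
  assumes "Lindelof_space X"
    and "\<And>x. x \<in> topspace X \<Longrightarrow> \<exists>U w. openin X U \<and> x \<in> U \<and> w \<in> P \<and> (\<forall>y\<in>U. R y w)"
    and "P \<noteq> {}"
  shows "\<exists>w :: nat \<Rightarrow> 'b. range w \<subseteq> P \<and> (\<forall>y\<in>topspace X. \<exists>n. R y (w n))"
proof -
  obtain U v where Uv: "\<And>x. x \<in> topspace X \<Longrightarrow>
      openin X (U x) \<and> x \<in> U x \<and> v x \<in> P \<and> (\<forall>y\<in>U x. R y (v x))"
    using assms(2) by metis
  have "\<Union>(U ` topspace X) = topspace X"
    using Uv openin_subset by fastforce
  moreover have "\<And>W. W \<in> U ` topspace X \<Longrightarrow> openin X W"
    using Uv by auto
  ultimately obtain \<V> where "countable \<V>" "\<V> \<subseteq> U ` topspace X" "\<Union>\<V> = topspace X"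
    using Lindelof_spaceD[OF assms(1)] by metis
  then obtain C where C: "countable C" "C \<subseteq> topspace X" "\<Union>(U ` C) = topspace X"
    by (metis countable_subset_image)
  show ?thesis
  proof (cases "C = {}")
    \<comment> \<open>An empty subcover means an empty space, so a constant sequence with any value
      in \<open>P\<close> will do.\<close>
    case True
    obtain p where "p \<in> P"
      using assms(3) by blast
    then show ?thesis
      using C True by (intro exI[of _ "\<lambda>n. p"]) auto
  next
    case False
    define w where "w = v \<circ> from_nat_into C"
    have "from_nat_into C n \<in> topspace X" for n
      using from_nat_into[OF False] C by blast
    then have "range w \<subseteq> P"
      using Uv by (auto simp: w_def)
    moreover have "\<exists>n. R y (w n)" if y: "y \<in> topspace X" for y
    proof -
      obtain c where c: "c \<in> C" "y \<in> U c"
        using y C by blast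
      moreover obtain n where "from_nat_into C n = c"
        using from_nat_into_surj[OF C(1) c(1)] by blast
      ultimately have "R y (w n)"
        using Uv C by (auto simp: w_def)
      then show ?thesis ..
    qed
    ultimately show ?thesis
      by blast
  qed
qed

text \<open>The extra argument in \<open>nat\<close> lets the single function \<open>f\<close>
  encode countably many binary operations.\<close>

lemma countable_closure:
  fixes f :: "'b \<Rightarrow> 'b \<Rightarrow> nat \<Rightarrow> 'b"
  assumes "a \<in> P" and "\<And>x y n. x \<in> P \<Longrightarrow> y \<in> P \<Longrightarrow> f x y n \<in> P"
  shows "\<exists>C. countable C \<and> a \<in> C \<and> C \<subseteq> P \<and> (\<forall>x\<in>C. \<forall>y\<in>C. \<forall>n. f x y n \<in> C)"
proof -
  define S where "S = rec_nat {a} (\<lambda>_ A. A \<union> (\<lambda>(x, y, n). f x y n) ` (A \<times> A \<times> UNIV))"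
  have S: "S 0 = {a}" "S (Suc k) = S k \<union> (\<lambda>(x, y, n). f x y n) ` (S k \<times> S k \<times> UNIV)" for k
    by (auto simp: S_def)
  have cP: "countable (S k) \<and> S k \<subseteq> P" for k
    by (induction k) (use assms in \<open>auto simp: S\<close>)
  have mono: "S j \<subseteq> S k" if "j \<le> k" for j k
    by (rule lift_Suc_mono_le[OF _ that]) (simp add: S)
  have closed: "\<exists>k. f x y n \<in> S k" if "x \<in> S i" "y \<in> S j" for x y n i j
  proof -
    have "x \<in> S (max i j)" "y \<in> S (max i j)"
      using that mono[of i "max i j"] mono[of j "max i j"] by auto
    then have "f x y n \<in> S (Suc (max i j))"
      unfolding S by (intro UnI2 image_eqI[of _ _ "(x, y, n)"]) auto
    then show ?thesis ..
  qed
  show ?thesis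
  proof (intro exI[of _ "\<Union>k. S k"] conjI ballI allI)
    show "a \<in> (\<Union>k. S k)"
      using S(1) by blast
  qed (use cP closed in auto)
qed

section \<open>Invariant neighbourhoods\<close>

context topological_gyrogroup
begin

lemma continuous_map_gplus:
  assumes "continuous_map X T f" "continuous_map X T g"
  shows "continuous_map X T (\<lambda>x. f x \<oplus> g x)"
  using continuous_map_compose[OF continuous_map_pairedI[OF assms] continuous_gplus]
  by (simp add: o_def)

lemma continuous_map_gminus:
  "continuous_map X T f \<Longrightarrow> continuous_map X T (\<lambda>x. gminus (f x))"
  using continuous_map_compose[OF _ continuous_gminus] by (simp add: o_def)

lemma continuous_map_rdiv:
  assumes "continuous_map X T f" "continuous_map X T g"
  shows "continuous_map X T (\<lambda>x. rdiv (f x) (g x))"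
  unfolding rdiv_def by (intro continuous_map_gplus continuous_map_gminus assms)

lemma continuous_map_gconst: "c \<in> topspace T \<Longrightarrow> continuous_map X T (\<lambda>x. c)"
  by simp

lemmas gcont = continuous_map_gplus continuous_map_gminus continuous_map_rdiv
  continuous_map_gconst continuous_map_id[unfolded id_def] continuous_map_fst continuous_map_snd

lemma openin_set_gplus:
  assumes "openin T A" "strong_sub H"
  shows "openin T (A \<boxplus> H)"
proof -
  have "openin T {g \<in> topspace T. g \<oplus> h \<in> A}" if "h \<in> H" for h
    using that strong_sub_subset[OF assms(2)] assms(1)
    by (intro openin_continuous_map_preimage[where Y = T] gcont) auto
  then show ?thesis
    using assms openin_subset by (subst set_gplus_strong_sub_eq) auto
qed

lemma openin_translate:
  assumes "openin T A" "x \<in> topspace T"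
  shows "openin T ((\<oplus>) x ` A)"
proof -
  have A: "A \<subseteq> topspace T"
    using assms openin_subset by blast
  have "(\<oplus>) x ` A = {g \<in> topspace T. gminus x \<oplus> g \<in> A}"
  proof safe
    fix a assume "a \<in> A"
    then have "a \<in> topspace T"
      using A by blast
    then show "x \<oplus> a \<in> topspace T" "gminus x \<oplus> (x \<oplus> a) \<in> A"
      using assms \<open>a \<in> A\<close> by (auto simp: gplus_closed minus_add_cancel)
  next
    fix g assume "g \<in> topspace T" "gminus x \<oplus> g \<in> A"
    then show "g \<in> (\<oplus>) x ` A"
      using assms add_minus_cancel[of x g] by (metis image_eqI)
  qed
  then show ?thesis
    using assms by (simp, intro openin_continuous_map_preimage[where Y = T] gcont) (auto simp: gminus_closed)
qed

lemma closedin_coset: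
  assumes "closedin T H" "strong_sub H" "x \<in> topspace T"
  shows "closedin T ((\<oplus>) x ` H)"
proof -
  have "(\<oplus>) x ` H = {g \<in> topspace T. gminus x \<oplus> g \<in> H}"
    using coset_iff[OF assms(2,3)] by blast
  then show ?thesis
    using assms by (simp, intro closedin_continuous_map_preimage[where Y = T] gcont) (auto simp: gminus_closed)
qed

definition invariant_nhd :: "'a set \<Rightarrow> bool" where
  "invariant_nhd V \<longleftrightarrow> openin T V \<and> \<zero> \<in> V \<and> gminus ` V \<subseteq> V \<and> gyr_invariant V"

lemma invariant_nhdD:
  assumes "invariant_nhd V"
  shows "openin T V" "\<zero> \<in> V" "\<And>x. x \<in> V \<Longrightarrow> gminus x \<in> V" "gyr_invariant V"
    "V \<subseteq> topspace T"
  using assms openin_subset by (auto simp: invariant_nhd_def)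

lemma invariant_nhd_Int:
  assumes "invariant_nhd V" "invariant_nhd W"
  shows "invariant_nhd (V \<inter> W)"
  using assms gyr_invariant_Inter[of "{V, W}"] by (auto simp: invariant_nhd_def)

lemma invariant_nhd_topspace: "invariant_nhd (topspace T)"
proof -
  have "gyr x y ` topspace T = topspace T" if "x \<in> topspace T" "y \<in> topspace T" for x y
    using gyr_bij[OF that] by (simp add: bij_betw_def)
  then show ?thesis
    by (auto simp: invariant_nhd_def gyr_invariant_def gzero_closed gminus_closed)
qed

text \<open>For \<open>b\<close> near \<open>p\<close> the right quotient of \<open>b\<close> by
  \<open>p\<close> lies in \<open>V\<close>. Taking such a \<open>b\<close> in
  \<open>V \<boxplus> H\<close> and solving for \<open>p\<close> with the symmetry of
  \<open>V\<close> puts \<open>p\<close> into \<open>V \<boxplus> (V \<boxplus> H)\<close>.\<close>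

lemma closure_of_set_gplus:
  assumes "invariant_nhd V" "strong_sub H"
  shows "T closure_of (V \<boxplus> H) \<subseteq> (V \<boxplus> V) \<boxplus> H"
proof
  note V = invariant_nhdD[OF assms(1)] and HG = strong_sub_subset[OF assms(2)]
  fix p assume p: "p \<in> T closure_of (V \<boxplus> H)"
  then have pG: "p \<in> topspace T"
    by (meson closure_of_subset_topspace subsetD)
  define E where "E = {b \<in> topspace T. rdiv b p \<in> V}"
  have "openin T E"
    unfolding E_def using pG V by (intro openin_continuous_map_preimage[where Y = T] gcont)
  moreover have "p \<in> E"
    using pG V by (simp add: E_def rdiv_self)
  ultimately obtain b where b: "b \<in> E" "b \<in> V \<boxplus> H"
    using p by (auto simp: in_closure_of)
  then obtain v h where vh: "v \<in> V" "h \<in> H" "b = v \<oplus> h"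
    by (auto simp: set_gplus_def)
  define u where "u = rdiv b p"
  have u: "u \<in> V" "u \<oplus> p = b" "u \<in> topspace T"
    using b pG V by (auto simp: u_def E_def rdiv_add)
  then have "p = gminus u \<oplus> (v \<oplus> h)"
    using pG vh minus_add_cancel by metis
  moreover have "gminus u \<in> V"
    using u V by auto
  ultimately have "p \<in> V \<boxplus> (V \<boxplus> H)"
    using vh by (auto simp: set_gplus_def)
  then show "p \<in> (V \<boxplus> V) \<boxplus> H"
    using set_gplus_assoc_subset[of V V H] V strong_sub_invariant[OF assms(2)] by blast
qed

lemma openin_gyr_image:
  assumes "openin T A" "x \<in> topspace T" "y \<in> topspace T"
  shows "openin T (gyr x y ` A)"
proof -
  have A: "A \<subseteq> topspace T"
    using assms openin_subset by blast
  have "gyr x y ` A = {w \<in> topspace T. gminus y \<oplus> (gminus x \<oplus> ((x \<oplus> y) \<oplus> w)) \<in> A}"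
  proof safe
    fix a assume "a \<in> A"
    then have "a \<in> topspace T"
      using A by blast
    then show "gyr x y a \<in> topspace T"
      "gminus y \<oplus> (gminus x \<oplus> ((x \<oplus> y) \<oplus> gyr x y a)) \<in> A"
      using assms \<open>a \<in> A\<close> by (auto simp: gyr_closed gyr_assoc[symmetric] gplus_closed minus_add_cancel)
  next
    fix w assume "w \<in> topspace T" "gminus y \<oplus> (gminus x \<oplus> ((x \<oplus> y) \<oplus> w)) \<in> A"
    then show "w \<in> gyr x y ` A"
      using assms gyr_inverse[of x y w] by (metis image_eqI)
  qed
  then show ?thesis
    using assms
    by (simp, intro openin_continuous_map_preimage[where Y = T] gcont) (auto simp: gminus_closed gplus_closed)
qed

lemma openin_gyr_preimage:
  assumes "openin T A" "x \<in> topspace T" "y \<in> topspace T"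
  shows "openin T {z \<in> topspace T. gyr x y z \<in> A}"
proof -
  have "{z \<in> topspace T. gyr x y z \<in> A} =
      {z \<in> topspace T. gminus (x \<oplus> y) \<oplus> (x \<oplus> (y \<oplus> z)) \<in> A}"
    using assms by (auto simp: gyr_eq)
  then show ?thesis
    using assms
    by (simp, intro openin_continuous_map_preimage[where Y = T] gcont) (auto simp: gminus_closed gplus_closed)
qed

end

context strongly_topological_gyrogroup
begin

text \<open>Members of the given base may be neither open nor symmetric. The interior of an
  invariant set stays invariant because gyrations are homeomorphisms, and intersecting it with its
  set of inverses restores symmetry, since gyrations commute with inversion.\<close>

lemma invariant_nhd_exists:
  assumes "openin T W" "\<zero> \<in> W"
  obtains V where "invariant_nhd V" "V \<subseteq> W"
proof -
  obtain U where U: "U \<subseteq> topspace T" "\<zero> \<in> T interior_of U" "U \<subseteq> W"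
    "\<And>x y. x \<in> topspace T \<Longrightarrow> y \<in> topspace T \<Longrightarrow> gyr x y ` U = U"
    using gyr_invariant_base assms unfolding is_neighborhood_base_def by metis
  define I where "I = T interior_of U"
  have I: "openin T I" "I \<subseteq> U" "\<zero> \<in> I" "I \<subseteq> topspace T"
    using U by (auto simp: I_def interior_of_subset interior_of_subset_topspace)
  have gyrI: "gyr x y ` I = I" if xy: "x \<in> topspace T" "y \<in> topspace T" for x y
  proof
    have "gyr x y ` I \<subseteq> U"
      using U(4)[OF xy] I(2) by blast
    then show "gyr x y ` I \<subseteq> I"
      using openin_gyr_image[OF I(1) xy] by (simp add: I_def interior_of_maximal)
    \<comment> \<open>The preimage of \<open>I\<close> is open and, by injectivity, contained in
      \<open>U\<close>; hence it lies in the interior \<open>I\<close>, which gives the reverse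
      inclusion.\<close>
    define J where "J = {z \<in> topspace T. gyr x y z \<in> I}"
    have "J \<subseteq> U"
    proof
      fix z assume z: "z \<in> J"
      then have "gyr x y z \<in> gyr x y ` U"
        using U(4)[OF xy] I(2) by (auto simp: J_def)
      then obtain z' where "z' \<in> U" "gyr x y z = gyr x y z'"
        by blast
      then show "z \<in> U"
        using gyr_inj[OF xy, of z z'] z U(1) by (auto simp: J_def)
    qed
    then have "J \<subseteq> I"
      using openin_gyr_preimage[OF I(1) xy] by (simp add: I_def J_def interior_of_maximal)
    moreover have "I \<subseteq> gyr x y ` J"
    proof
      fix w assume w: "w \<in> I"
      then have "w \<in> gyr x y ` topspace T"
        using gyr_bij[OF xy] I(4) by (auto simp: bij_betw_def)
      then show "w \<in> gyr x y ` J"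
        using w by (auto simp: J_def)
    qed
    ultimately show "I \<subseteq> gyr x y ` I"
      by blast
  qed
  define V where "V = I \<inter> {x \<in> topspace T. gminus x \<in> I}"
  have "openin T V"
    unfolding V_def using I
    by (intro openin_Int openin_continuous_map_preimage[where Y = T] gcont)
  moreover have "gyr_invariant V"
    unfolding gyr_invariant_def
  proof (intro conjI ballI)
    show "V \<subseteq> topspace T" by (auto simp: V_def)
    fix x y assume xy: "x \<in> topspace T" "y \<in> topspace T"
    show "gyr x y ` V = V"
    proof
      show "gyr x y ` V \<subseteq> V"
      proof
        fix w assume "w \<in> gyr x y ` V"
        then obtain z where z: "w = gyr x y z" "z \<in> I" "z \<in> topspace T" "gminus z \<in> I"
          by (auto simp: V_def)
        then have "w \<in> gyr x y ` I" "gminus w \<in> gyr x y ` I" "w \<in> topspace T"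
          using gyr_minus[OF xy] gyr_closed[OF xy] by (metis image_eqI, metis image_eqI, simp)
        then show "w \<in> V"
          using gyrI[OF xy] by (simp add: V_def)
      qed
      show "V \<subseteq> gyr x y ` V"
      proof
        fix w assume w: "w \<in> V"
        then have "w \<in> gyr x y ` I" "gminus w \<in> gyr x y ` I"
          using gyrI[OF xy] by (auto simp: V_def)
        then obtain z z' where z: "z \<in> I" "w = gyr x y z" "z' \<in> I" "gminus w = gyr x y z'"
          by auto
        moreover have zG: "z \<in> topspace T" "z' \<in> topspace T"
          using z I by auto
        ultimately have "gyr x y (gminus z) = gyr x y z'"
          using gyr_minus[OF xy] by metis
        then have "gminus z = z'"
          using gyr_inj[OF xy, of "gminus z" z'] zG gminus_closed by blast
        then show "w \<in> gyr x y ` V"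
          using z zG by (auto simp: V_def)
      qed
    qed
  qed
  moreover have "\<zero> \<in> V" "gminus ` V \<subseteq> V"
    using I by (auto simp: V_def minus_zero gzero_closed minus_minus gminus_closed)
  moreover have "V \<subseteq> W"
    using U I by (auto simp: V_def)
  ultimately show thesis
    using that by (simp add: invariant_nhd_def)
qed

lemma invariant_nhd_half:
  assumes "openin T W" "\<zero> \<in> W"
  obtains V where "invariant_nhd V" "V \<boxplus> V \<subseteq> W"
proof -
  define Q where "Q = {p \<in> topspace (prod_topology T T). (\<lambda>(x, y). x \<oplus> y) p \<in> W}"
  have "openin (prod_topology T T) Q"
    unfolding Q_def using continuous_gplus assms(1) by (rule openin_continuous_map_preimage)
  moreover have "(\<zero>, \<zero>) \<in> Q"
    using assms by (simp add: Q_def gzero_closed gzero_left)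
  ultimately obtain A B where AB: "openin T A" "openin T B" "\<zero> \<in> A" "\<zero> \<in> B" "A \<times> B \<subseteq> Q"
    unfolding openin_prod_topology_alt by metis
  obtain V where V: "invariant_nhd V" "V \<subseteq> A \<inter> B"
    using invariant_nhd_exists[of "A \<inter> B"] AB openin_Int by blast
  have "V \<boxplus> V \<subseteq> W"
  proof
    fix x assume "x \<in> V \<boxplus> V"
    then obtain v w where "v \<in> V" "w \<in> V" "x = v \<oplus> w"
      by (auto simp: set_gplus_def)
    moreover then have "(v, w) \<in> A \<times> B"
      using V(2) by blast
    ultimately show "x \<in> W"
      using AB(5) by (auto simp: Q_def)
  qed
  with V(1) show thesis
    by (rule that)
qed

end

section \<open>Cosets and saturated sets\<close>

locale coset_space_setup = strongly_topological_gyrogroup +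
  fixes N :: "'a set"
  assumes strong_sub_N: "strong_sub N"
    and closedin_N: "closedin T N"
begin

definition coset :: "'a \<Rightarrow> 'a set" where
  "coset a = (\<oplus>) a ` N"

abbreviation X :: "'a set topology" where
  "X \<equiv> coset_space T (\<oplus>) N"

lemma X_eq: "X = quotient_topology T coset"
  by (simp add: coset_space_def coset_def[abs_def])

lemma topspace_X: "topspace X = coset ` topspace T"
  by (simp add: X_eq topspace_quotient_topology)

text \<open>These sets are the unions of left cosets of \<open>N\<close>. They represent subsets of
  \<open>X\<close> inside \<open>G\<close>, so that most arguments about \<open>X\<close> can be
  carried out in \<open>G\<close>.\<close>

definition saturated :: "'a set \<Rightarrow> bool" where
  "saturated A \<longleftrightarrow> A \<subseteq> topspace T \<and> (\<forall>a\<in>A. \<forall>n\<in>N. a \<oplus> n \<in> A)"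

lemma coset_mem_image:
  assumes "saturated A" "x \<in> topspace T"
  shows "coset x \<in> coset ` A \<longleftrightarrow> x \<in> A"
proof
  assume "coset x \<in> coset ` A"
  then obtain a where a: "a \<in> A" "coset x = coset a"
    by auto
  then have "x \<in> coset a"
    using self_in_coset[OF strong_sub_N assms(2)] by (simp add: coset_def)
  then show "x \<in> A"
    using a assms by (auto simp: saturated_def coset_def)
qed auto

lemma saturated_Diff:
  assumes "saturated A"
  shows "saturated (topspace T - A)"
  unfolding saturated_def
proof (intro conjI ballI)
  fix a n assume a: "a \<in> topspace T - A" and n: "n \<in> N"
  then have nG: "n \<in> topspace T"
    using strong_sub_subset[OF strong_sub_N] by blast
  have "a \<oplus> n \<notin> A"
  proof
    assume *: "a \<oplus> n \<in> A"
    have "a \<in> (\<oplus>) (a \<oplus> n) ` N"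
      using coset_sym[OF strong_sub_N, of a "a \<oplus> n"] a n by blast
    then obtain m where "m \<in> N" "a = (a \<oplus> n) \<oplus> m"
      by blast
    then have "a \<in> A"
      using * assms unfolding saturated_def by metis
    then show False
      using a by simp
  qed
  then show "a \<oplus> n \<in> topspace T - A"
    using a nG by (simp add: gplus_closed)
qed auto

lemma openin_coset_image:
  assumes "openin T A" "saturated A"
  shows "openin X (coset ` A)"
proof -
  have "{x \<in> topspace T. coset x \<in> coset ` A} = A"
    using coset_mem_image[OF assms(2)] assms(2) by (auto simp: saturated_def)
  then show ?thesis
    using assms by (auto simp: X_eq openin_quotient_topology saturated_def)
qed

lemma closedin_coset_image:
  assumes "closedin T A" "saturated A"
  shows "closedin X (coset ` A)"
proof -
  have "coset ` topspace T - coset ` A = coset ` (topspace T - A)"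
    using coset_mem_image[OF assms(2)] by auto
  moreover have "coset ` A \<subseteq> coset ` topspace T"
    using assms(2) by (auto simp: saturated_def)
  ultimately show ?thesis
    using openin_coset_image[of "topspace T - A"] assms saturated_Diff[OF assms(2)]
    by (simp add: closedin_def topspace_X)
qed

lemma coset_preimage:
  assumes "openin X W"
  shows "openin T {x \<in> topspace T. coset x \<in> W}" "saturated {x \<in> topspace T. coset x \<in> W}"
proof -
  show "openin T {x \<in> topspace T. coset x \<in> W}"
    using assms by (simp add: X_eq openin_quotient_topology)
  have "coset (a \<oplus> n) = coset a" if "a \<in> topspace T" "n \<in> N" for a n
    using coset_eq[OF strong_sub_N, of a "a \<oplus> n"] that unfolding coset_def by blast
  then show "saturated {x \<in> topspace T. coset x \<in> W}"
    using strong_sub_subset[OF strong_sub_N] by (auto simp: saturated_def gplus_closed)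
qed

lemma saturated_set_gplus:
  assumes "strong_sub H" "N \<subseteq> H" "A \<subseteq> topspace T"
  shows "saturated (A \<boxplus> H)"
  unfolding saturated_def
proof (intro conjI ballI)
  show "A \<boxplus> H \<subseteq> topspace T"
    using assms by (simp add: set_gplus_closed strong_sub_subset)
  fix a n assume "a \<in> A \<boxplus> H" "n \<in> N"
  then have "a \<oplus> n \<in> (A \<boxplus> H) \<boxplus> H"
    unfolding set_gplus_def[of "A \<boxplus> H"] using assms(2) by blast
  then show "a \<oplus> n \<in> A \<boxplus> H"
    using strong_sub_absorb[OF assms(1,3)] by blast
qed

lemma saturated_set_gplus_subset: "saturated A \<Longrightarrow> B \<subseteq> A \<Longrightarrow> B \<boxplus> N \<subseteq> A"
  by (auto simp: saturated_def set_gplus_def subset_iff)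

text \<open>Right translation by an element of \<open>N\<close> is continuous and maps
  \<open>A\<close> into itself, so it maps the closure into itself.\<close>

lemma saturated_closure_of:
  assumes "saturated A"
  shows "saturated (T closure_of A)"
  unfolding saturated_def
proof (intro conjI ballI)
  show "T closure_of A \<subseteq> topspace T"
    by (rule closure_of_subset_topspace)
  fix a n assume a: "a \<in> T closure_of A" and n: "n \<in> N"
  then have "continuous_map T T (\<lambda>g. g \<oplus> n)"
    using strong_sub_subset[OF strong_sub_N] by (intro gcont) auto
  then have "(\<lambda>g. g \<oplus> n) ` (T closure_of A) \<subseteq> T closure_of ((\<lambda>g. g \<oplus> n) ` A)"
    by (rule continuous_map_image_closure_subset)
  also have "\<dots> \<subseteq> T closure_of A"
    using assms n by (intro closure_of_mono) (auto simp: saturated_def)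
  finally show "a \<oplus> n \<in> T closure_of A"
    using a by blast
qed

lemma saturated_translate:
  assumes "saturated A" "x \<in> topspace T"
  shows "saturated {g \<in> topspace T. x \<oplus> g \<in> A}"
  unfolding saturated_def
proof (intro conjI ballI)
  fix g n assume g: "g \<in> {g \<in> topspace T. x \<oplus> g \<in> A}" and n: "n \<in> N"
  have nG: "n \<in> topspace T"
    using n strong_sub_subset[OF strong_sub_N] by blast
  obtain n' where "n' \<in> N" "x \<oplus> (g \<oplus> n) = (x \<oplus> g) \<oplus> n'"
    using gyr_invariant_assoc_right[OF strong_sub_invariant[OF strong_sub_N], of x g n]
      assms g n by blast
  then show "g \<oplus> n \<in> {g \<in> topspace T. x \<oplus> g \<in> A}"
    using assms g nG by (simp add: saturated_def gplus_closed)
qed auto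

lemma saturated_coset:
  assumes "strong_sub H" "N \<subseteq> H" "x \<in> topspace T"
  shows "saturated ((\<oplus>) x ` H)"
  using coset_absorb[OF assms(1,3)] coset_iff[OF assms(1,3)] assms(2)
  unfolding saturated_def by blast

text \<open>Compactness in \<open>X\<close>, restated for saturated closed subsets of
  \<open>G\<close>. Saturation allows one to pass from a coset lying in an image back to the point
  lying in the set.\<close>

lemma compact_saturated_subfamily:
  assumes "closedin T C" "saturated C" "compactin X (coset ` C)"
    and "\<And>D. D \<in> \<D> \<Longrightarrow> closedin T D \<and> saturated D"
    and "openin T U" "saturated U" "C \<inter> \<Inter>\<D> \<subseteq> U"
  obtains \<F> where "finite \<F>" "\<F> \<subseteq> \<D>" "C \<inter> \<Inter>\<F> \<subseteq> U"
proof -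
  \<comment> \<open>The cover of the compact image consists of the image of \<open>U\<close> and the
    images of the complements of the members of \<open>\<D>\<close>.\<close>
  define \<U> where "\<U> = insert (coset ` U) ((\<lambda>D. coset ` (topspace T - D)) ` \<D>)"
  have CG: "C \<subseteq> topspace T"
    using assms(2) by (simp add: saturated_def)
  have "openin X (coset ` (topspace T - D))" if "D \<in> \<D>" for D
    using assms(4)[OF that] by (intro openin_coset_image saturated_Diff) auto
  then have "openin X W" if "W \<in> \<U>" for W
    using that openin_coset_image[OF assms(5,6)] by (auto simp: \<U>_def)
  moreover have "coset ` C \<subseteq> \<Union>\<U>"
  proof
    fix w assume "w \<in> coset ` C"
    then obtain x where x: "x \<in> C" "w = coset x"
      by blast
    show "w \<in> \<Union>\<U>"
    proof (cases "x \<in> U")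
      case False
      then obtain D where "D \<in> \<D>" "x \<in> topspace T - D"
        using x assms(7) CG by blast
      then show ?thesis
        unfolding \<U>_def x(2) by blast
    qed (simp add: \<U>_def x(2))
  qed
  ultimately obtain \<V> where \<V>: "finite \<V>" "\<V> \<subseteq> \<U>" "coset ` C \<subseteq> \<Union>\<V>"
    using assms(3) unfolding compactin_def by meson
  have "finite (\<V> - {coset ` U})" "\<V> - {coset ` U} \<subseteq> (\<lambda>D. coset ` (topspace T - D)) ` \<D>"
    using \<V> by (auto simp: \<U>_def)
  then obtain \<F> where \<F>: "\<F> \<subseteq> \<D>" "finite \<F>"
    "\<V> - {coset ` U} = (\<lambda>D. coset ` (topspace T - D)) ` \<F>"
    by (meson finite_subset_image)
  have "x \<in> U" if x: "x \<in> C" "x \<in> \<Inter>\<F>" for x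
  proof -
    obtain W where W: "W \<in> \<V>" "coset x \<in> W"
      using \<V>(3) x by blast
    have xG: "x \<in> topspace T"
      using x CG by blast
    have "W = coset ` U"
    proof (rule ccontr)
      assume "W \<noteq> coset ` U"
      then have "W \<in> (\<lambda>D. coset ` (topspace T - D)) ` \<F>"
        unfolding \<F>(3)[symmetric] using W by simp
      then obtain D where D: "D \<in> \<F>" "W = coset ` (topspace T - D)"
        by (rule imageE)
      then have "saturated D"
        using assms(4) \<F>(1) by (meson subsetD)
      then have "x \<in> topspace T - D"
        using coset_mem_image[OF saturated_Diff xG] W(2) D(2) by simp
      then show False
        using D(1) x(2) by simp
    qed
    then show ?thesis
      using W coset_mem_image[OF assms(6) xG] by simp
  qed
  then show thesis
    by (intro that[OF \<F>(2,1)] subsetI) auto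
qed

section \<open>Admissible subgyrogroups\<close>

text \<open>The last clause provides a compact neighbourhood in \<open>X\<close> of the image of
  \<open>H\<close>. This makes the image of \<open>H\<close> compact and also permits compactness
  arguments with the closures of sets \<open>V \<boxplus> H\<close>.\<close>

definition admissible :: "'a set \<Rightarrow> bool" where
  "admissible H \<longleftrightarrow> strong_sub H \<and> closedin T H \<and> N \<subseteq> H \<and>
     (\<exists>V. invariant_nhd V \<and> compactin X (coset ` (T closure_of (V \<boxplus> H))))"

lemma compactin_coset_image_subset:
  assumes "compactin X (coset ` B)" "closedin T A" "saturated A" "A \<subseteq> B"
  shows "compactin X (coset ` A)"
  using closed_compactin[OF assms(1) _ closedin_coset_image[OF assms(2,3)]] assms(4) by blast

text \<open>As \<open>H\<close> is closed, \<open>gminus w \<oplus> g\<close> avoids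
  \<open>H\<close> for all \<open>w\<close> near \<open>\<zero>\<close>. Halving that neighbourhood
  leaves room for the closure.\<close>

lemma closure_of_set_gplus_separates:
  assumes "closedin T H" "strong_sub H" "g \<in> topspace T" "g \<notin> H"
  obtains V where "invariant_nhd V" "g \<notin> T closure_of (V \<boxplus> H)"
proof -
  have "openin T {w \<in> topspace T. gminus w \<oplus> g \<in> topspace T - H}"
    using assms by (intro openin_continuous_map_preimage[where Y = T] gcont) auto
  moreover have "\<zero> \<in> {w \<in> topspace T. gminus w \<oplus> g \<in> topspace T - H}"
    using assms by (simp add: gzero_closed minus_zero gzero_left)
  ultimately obtain V where V: "invariant_nhd V"
    "V \<boxplus> V \<subseteq> {w \<in> topspace T. gminus w \<oplus> g \<in> topspace T - H}"
    by (rule invariant_nhd_half)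
  have "g \<notin> (V \<boxplus> V) \<boxplus> H"
  proof
    assume "g \<in> (V \<boxplus> V) \<boxplus> H"
    then obtain w h where wh: "w \<in> V \<boxplus> V" "h \<in> H" "g = w \<oplus> h"
      by (auto simp: set_gplus_def[of "V \<boxplus> V"])
    then have "gminus w \<oplus> g = h"
      using V(2) strong_sub_subset[OF assms(2)] minus_add_cancel[of w h] by blast
    then show False
      using V(2) wh(1,2) by auto
  qed
  then show thesis
    using that V(1) closure_of_set_gplus[OF V(1) assms(2)] by blast
qed

text \<open>Finite intersections of sets \<open>V \<boxplus> M i\<close> form a neighbourhood base,
  among saturated open sets, of the intersection of all \<open>M i\<close>. The closures of the sets
  \<open>V \<boxplus> M i\<close> shrink to that intersection and one of them has compact image, so
  finitely many of them already lie in \<open>U\<close>.\<close>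

lemma admissible_Inter_subset:
  assumes "\<And>i. i \<in> S \<Longrightarrow> admissible (M i)"
    and "openin T U" "saturated U" "topspace T \<inter> (\<Inter>i\<in>S. M i) \<subseteq> U"
  obtains F V where "finite F" "F \<subseteq> S" "invariant_nhd V" "topspace T \<inter> (\<Inter>i\<in>F. V \<boxplus> M i) \<subseteq> U"
proof (cases "S = {}")
  case True
  then show thesis
    using that[of "{}" "topspace T"] assms(4) invariant_nhd_topspace by simp
next
  case False
  then obtain i0 where i0: "i0 \<in> S" by blast
  define K where "K i V = T closure_of (V \<boxplus> M i)" for i V
  define \<D> where "\<D> = {K i V | i V. i \<in> S \<and> invariant_nhd V}"
  have adm: "strong_sub (M i)" "closedin T (M i)" "N \<subseteq> M i" if "i \<in> S" for i
    using assms(1)[OF that] by (auto simp: admissible_def)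
  have satu: "saturated (V \<boxplus> M i)" if "i \<in> S" "invariant_nhd V" for i V
    using adm[OF that(1)] invariant_nhdD(5)[OF that(2)] by (intro saturated_set_gplus)
  have K: "closedin T (K i V)" "saturated (K i V)" if "i \<in> S" "invariant_nhd V" for i V
    using satu[OF that] by (auto simp: K_def saturated_closure_of)
  obtain V0 where V0: "invariant_nhd V0" "compactin X (coset ` K i0 V0)"
    using assms(1)[OF i0] by (auto simp: admissible_def K_def)
  have "K i0 V0 \<inter> \<Inter>\<D> \<subseteq> U"
  proof
    fix g assume g: "g \<in> K i0 V0 \<inter> \<Inter>\<D>"
    then have gG: "g \<in> topspace T"
      using K(2)[OF i0 V0(1)] by (auto simp: saturated_def)
    have "g \<in> M i" if i: "i \<in> S" for i
    proof (rule ccontr)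
      assume "g \<notin> M i"
      then obtain V where "invariant_nhd V" "g \<notin> K i V"
        using closure_of_set_gplus_separates[OF adm(2,1)[OF i] gG] unfolding K_def by metis
      then show False
        using g i by (auto simp: \<D>_def)
    qed
    then show "g \<in> U"
      using assms(4) gG by blast
  qed
  moreover have "closedin T D \<and> saturated D" if "D \<in> \<D>" for D
    using that K by (auto simp: \<D>_def)
  ultimately obtain \<F> where \<F>: "finite \<F>" "\<F> \<subseteq> \<D>" "K i0 V0 \<inter> \<Inter>\<F> \<subseteq> U"
    using compact_saturated_subfamily[OF K[OF i0 V0(1)] V0(2), of \<D> U] assms(2,3) by metis
  have "\<F> \<subseteq> (\<lambda>(i, V). K i V) ` (S \<times> Collect invariant_nhd)"
    using \<F>(2) by (auto simp: \<D>_def)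
  then obtain P where P: "P \<subseteq> S \<times> Collect invariant_nhd" "finite P" "\<F> = (\<lambda>(i, V). K i V) ` P"
    by (rule finite_subset_image[OF \<F>(1), elim_format]) blast
  \<comment> \<open>A single neighbourhood inside the finitely many that occur. Including
    \<open>V0\<close> here, and \<open>i0\<close> in \<open>F\<close> below, keeps the resulting
    intersection inside the compact piece \<open>K i0 V0\<close>.\<close>
  define V where "V = V0 \<inter> \<Inter>(snd ` P)"
  have "invariant_nhd (V0 \<inter> \<Inter>\<Q>)" if "finite \<Q>" "\<Q> \<subseteq> Collect invariant_nhd" for \<Q>
    using that
  proof (induction \<Q>)
    case (insert Q \<Q>)
    then have "invariant_nhd (Q \<inter> (V0 \<inter> \<Inter>\<Q>))"
      using invariant_nhd_Int[of Q "V0 \<inter> \<Inter>\<Q>"] by simp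
    then show ?case
      by (simp add: Int_left_commute)
  qed (use V0 in simp)
  moreover have "snd ` P \<subseteq> Collect invariant_nhd"
    using P(1) by (rule order_trans[OF image_mono]) auto
  ultimately have V: "invariant_nhd V"
    using P(2) by (simp add: V_def)
  define F where "F = insert i0 (fst ` P)"
  have sub: "V \<boxplus> M i \<subseteq> K i W" if "i \<in> S" "V \<subseteq> W" "invariant_nhd W" for i W
  proof -
    have "V \<boxplus> M i \<subseteq> W \<boxplus> M i"
      using that by (simp add: set_gplus_mono)
    also have "\<dots> \<subseteq> K i W"
      using satu[OF that(1,3)] by (auto simp: K_def saturated_def intro!: closure_of_subset)
    finally show ?thesis .
  qed
  have "topspace T \<inter> (\<Inter>i\<in>F. V \<boxplus> M i) \<subseteq> K i0 V0 \<inter> \<Inter>\<F>"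
  proof
    fix g assume g: "g \<in> topspace T \<inter> (\<Inter>i\<in>F. V \<boxplus> M i)"
    have "g \<in> K i0 V0"
      using g sub[OF i0, of V0] V0 by (auto simp: F_def V_def)
    moreover have "g \<in> K i W" if "(i, W) \<in> P" for i W
    proof -
      have "i \<in> F" "V \<subseteq> W" "i \<in> S" "invariant_nhd W"
        using that P(1) by (force simp: F_def V_def)+
      then show ?thesis
        using g sub by blast
    qed
    ultimately show "g \<in> K i0 V0 \<inter> \<Inter>\<F>"
      using P(3) by auto
  qed
  moreover have "finite F" "F \<subseteq> S"
    using P i0 by (auto simp: F_def)
  ultimately show thesis
    using that V \<F>(3) by (meson subset_trans)
qed

end

section \<open>Subgyrogroups with second countable quotient\<close>

locale Lindelof_coset_space = coset_space_setup +
  assumes Lindelof: "Lindelof_space T"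
    and locally_compact: "locally_compact_space X"
begin

text \<open>Local compactness of \<open>X\<close> at the coset of \<open>\<zero>\<close>, pulled
  back to \<open>G\<close>.\<close>

lemma compact_invariant_nhd:
  obtains V where "invariant_nhd V"
    "\<And>A. closedin T A \<Longrightarrow> saturated A \<Longrightarrow> A \<subseteq> V \<boxplus> N \<Longrightarrow> compactin X (coset ` A)"
proof -
  have "coset \<zero> \<in> topspace X"
    by (simp add: topspace_X gzero_closed)
  then obtain W K where WK: "openin X W" "compactin X K" "coset \<zero> \<in> W" "W \<subseteq> K"
    using locally_compact unfolding locally_compact_space_def by metis
  define P where "P = {x \<in> topspace T. coset x \<in> W}"
  have P: "openin T P" "saturated P" "\<zero> \<in> P"
    using coset_preimage[OF WK(1)] WK(3) by (auto simp: P_def gzero_closed)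
  obtain V where V: "invariant_nhd V" "V \<subseteq> P"
    using invariant_nhd_exists P by metis
  have "compactin X (coset ` A)" if "closedin T A" "saturated A" "A \<subseteq> V \<boxplus> N" for A
  proof -
    have "A \<subseteq> P"
      using that(3) saturated_set_gplus_subset[OF P(2) V(2)] by blast
    then have "coset ` A \<subseteq> K"
      using WK(4) by (auto simp: P_def)
    then show ?thesis
      using closed_compactin[OF WK(2)] closedin_coset_image that by metis
  qed
  with V(1) show thesis
    by (rule that)
qed

text \<open>The two conditions make the intersection of a suitable countable family of sets
  \<open>V \<boxplus> N\<close> closed under addition and under inversion.\<close>

lemma invariant_nhd_sequence:
  assumes "invariant_nhd V"
  shows "\<exists>w :: nat \<Rightarrow> 'a set. range w \<subseteq> Collect invariant_nhd \<and>
    (\<forall>y\<in>topspace T. \<exists>n. (y \<in> N \<longrightarrow> (\<forall>v\<in>w n. y \<oplus> v \<in> V \<boxplus> N)) \<and>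
       (\<forall>v\<in>w n. rdiv (gminus y) (gminus (gminus v \<oplus> y)) \<in> V))"
proof (rule Lindelof_space_sequence[OF Lindelof])
  note V = invariant_nhdD[OF assms]
  fix x assume x: "x \<in> topspace T"
  \<comment> \<open>The implication from \<open>y \<in> N\<close> becomes the union of
    \<open>Q1\<close> and \<open>Q2\<close>, where \<open>Q2\<close> is open because
    \<open>N\<close> is closed. All conditions hold at \<open>(x, \<zero>)\<close>, so they hold on
    a product neighbourhood of it.\<close>
  define Q1 where "Q1 = {p \<in> topspace (prod_topology T T). fst p \<oplus> snd p \<in> V \<boxplus> N}"
  define Q2 where "Q2 = {p \<in> topspace (prod_topology T T). fst p \<in> topspace T - N}"
  \<comment> \<open>If \<open>y = v \<oplus> n\<close> then \<open>gminus v \<oplus> y = n\<close>,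
    so this quotient is the element that has to be added on the left of \<open>gminus n\<close> to
    obtain \<open>gminus y\<close>.\<close>
  define Q3 where "Q3 = {p \<in> topspace (prod_topology T T).
      rdiv (gminus (fst p)) (gminus (gminus (snd p) \<oplus> fst p)) \<in> V}"
  have "openin (prod_topology T T) Q1"
    unfolding Q1_def using openin_set_gplus[OF V(1) strong_sub_N]
    by (intro openin_continuous_map_preimage[where Y = T] gcont)
  moreover have "openin (prod_topology T T) Q2"
    unfolding Q2_def using closedin_N
    by (intro openin_continuous_map_preimage[where Y = T] gcont) auto
  moreover have "openin (prod_topology T T) Q3"
    unfolding Q3_def using V
    by (intro openin_continuous_map_preimage[where Y = T] gcont)
  ultimately have "openin (prod_topology T T) ((Q1 \<union> Q2) \<inter> Q3)"
    by blast
  moreover have "x \<in> V \<boxplus> N" if "x \<in> N"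
    using that subset_set_gplus_left[OF strong_sub_subset[OF strong_sub_N] V(2)] by blast
  then have "(x, \<zero>) \<in> (Q1 \<union> Q2) \<inter> Q3"
    using x V(2) by (auto simp: Q1_def Q2_def Q3_def gzero_closed gzero_right gzero_left
        minus_zero gminus_closed rdiv_self)
  ultimately obtain A B where AB: "openin T A" "openin T B" "x \<in> A" "\<zero> \<in> B"
    "A \<times> B \<subseteq> (Q1 \<union> Q2) \<inter> Q3"
    unfolding openin_prod_topology_alt by metis
  obtain W where W: "invariant_nhd W" "W \<subseteq> B"
    using invariant_nhd_exists[OF AB(2,4)] by metis
  have AB': "(y, v) \<in> (Q1 \<union> Q2) \<inter> Q3" if "y \<in> A" "v \<in> W" for y v
    using that W AB by blast
  have "(y \<in> N \<longrightarrow> (\<forall>v\<in>W. y \<oplus> v \<in> V \<boxplus> N)) \<and>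
      (\<forall>v\<in>W. rdiv (gminus y) (gminus (gminus v \<oplus> y)) \<in> V)" if "y \<in> A" for y
    using AB'[OF that] by (auto simp: Q1_def Q2_def Q3_def)
  then show "\<exists>A W. openin T A \<and> x \<in> A \<and> W \<in> Collect invariant_nhd \<and>
      (\<forall>y\<in>A. (y \<in> N \<longrightarrow> (\<forall>v\<in>W. y \<oplus> v \<in> V \<boxplus> N)) \<and>
      (\<forall>v\<in>W. rdiv (gminus y) (gminus (gminus v \<oplus> y)) \<in> V))"
    using AB W by blast
next
  show "Collect invariant_nhd \<noteq> {}"
    using assms by blast
qed

lemma closure_of_set_gplus_half:
  assumes "invariant_nhd V" "strong_sub H" "V \<boxplus> V \<subseteq> W"
  shows "T closure_of (V \<boxplus> H) \<subseteq> W \<boxplus> H"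
  using closure_of_set_gplus[OF assms(1,2)] set_gplus_mono[OF assms(3) order_refl, of H] by blast

text \<open>For a sum write \<open>x = v \<oplus> n\<close>; a \<open>W\<close> adapted to
  \<open>n\<close> lets \<open>n\<close> pass the approximation of the second summand. For an
  inverse write \<open>x = w \<oplus> m\<close> with \<open>W\<close> adapted to \<open>x\<close>;
  then \<open>gminus x\<close> is \<open>gminus m\<close> with an element of \<open>V\<close> added
  on the left.\<close>

lemma strong_sub_Inter_set_gplus:
  assumes "\<V> \<noteq> {}" and inv: "\<And>V. V \<in> \<V> \<Longrightarrow> invariant_nhd V"
    and half: "\<And>V. V \<in> \<V> \<Longrightarrow> \<exists>W\<in>\<V>. W \<boxplus> W \<subseteq> V"
    and tame: "\<And>V y. V \<in> \<V> \<Longrightarrow> y \<in> topspace T \<Longrightarrow> \<exists>W\<in>\<V>. (y \<in> N \<longrightarrow> (\<forall>v\<in>W. y \<oplus> v \<in> V \<boxplus> N)) \<and>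
       (\<forall>v\<in>W. rdiv (gminus y) (gminus (gminus v \<oplus> y)) \<in> V)"
  shows "strong_sub (\<Inter>V\<in>\<V>. V \<boxplus> N)"
proof -
  define H where "H = (\<Inter>V\<in>\<V>. V \<boxplus> N)"
  have N: "N \<subseteq> topspace T" "gyr_invariant N" "\<zero> \<in> N" "\<And>x. x \<in> N \<Longrightarrow> gminus x \<in> N"
    using strong_sub_N strong_sub_subset by (auto simp: strong_sub_def)
  have VG: "V \<subseteq> topspace T" "gyr_invariant V" "\<zero> \<in> V" if "V \<in> \<V>" for V
    using invariant_nhdD[OF inv[OF that]] by auto
  have Hinv: "gyr_invariant H"
    unfolding H_def using assms(1) VG N gyr_invariant_set_gplus by (intro gyr_invariant_Inter) auto
  then have HG: "H \<subseteq> topspace T"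
    by (simp add: gyr_invariant_def)
  have "\<zero> \<in> H"
    unfolding H_def using VG(3) N(3) subset_set_gplus_left[OF N(1)] by (meson INT_I subsetD)
  moreover have "x \<oplus> y \<in> H" if x: "x \<in> H" and y: "y \<in> H" for x y
    unfolding H_def
  proof
    fix V assume V: "V \<in> \<V>"
    obtain V1 where V1: "V1 \<in> \<V>" "V1 \<boxplus> V1 \<subseteq> V"
      using half[OF V] by blast
    obtain v n where vn: "v \<in> V1" "n \<in> N" "x = v \<oplus> n"
      using x V1(1) by (auto simp: H_def set_gplus_def)
    then have vnG: "v \<in> topspace T" "n \<in> topspace T"
      using VG(1)[OF V1(1)] N(1) by auto
    obtain W where W: "W \<in> \<V>" "\<forall>w\<in>W. n \<oplus> w \<in> V1 \<boxplus> N"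
      using tame[OF V1(1) vnG(2)] vn(2) by blast
    \<comment> \<open>The set \<open>W\<close> may depend on \<open>n\<close>, since
      \<open>y\<close> lies in \<open>W \<boxplus> N\<close> for every member of the family.\<close>
    have "gyr_invariant (W \<boxplus> N)" "y \<in> W \<boxplus> N"
      using gyr_invariant_set_gplus VG(2)[OF W(1)] N(2) y W(1) by (auto simp: H_def)
    then obtain y' where y': "y' \<in> W \<boxplus> N" "x \<oplus> y = v \<oplus> (n \<oplus> y')"
      using gyr_invariant_assoc_left[of "W \<boxplus> N" v n y] vnG vn(3) by metis
    then obtain w m where wm: "w \<in> W" "m \<in> N" "y' = w \<oplus> m"
      by (auto simp: set_gplus_def)
    then obtain m' where m': "m' \<in> N" "n \<oplus> y' = (n \<oplus> w) \<oplus> m'"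
      using gyr_invariant_assoc_right[OF N(2), of n w m] vnG VG(1)[OF W(1)] by (metis subsetD)
    have "n \<oplus> y' \<in> (V1 \<boxplus> N) \<boxplus> N"
      using m' W(2) wm(1) unfolding set_gplus_def[of "V1 \<boxplus> N"] by blast
    then have "n \<oplus> y' \<in> V1 \<boxplus> N"
      using strong_sub_absorb[OF strong_sub_N VG(1)[OF V1(1)]] by blast
    then have "x \<oplus> y \<in> V1 \<boxplus> (V1 \<boxplus> N)"
      using y'(2) vn(1) unfolding set_gplus_def[of V1 "V1 \<boxplus> N"] by blast
    then have "x \<oplus> y \<in> (V1 \<boxplus> V1) \<boxplus> N"
      using set_gplus_assoc_subset[OF _ _ N(2)] VG(1)[OF V1(1)] by blast
    then show "x \<oplus> y \<in> V \<boxplus> N"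
      using set_gplus_mono[OF V1(2) order_refl] by blast
  qed
  moreover have "gminus x \<in> H" if x: "x \<in> H" for x
    unfolding H_def
  proof
    fix V assume V: "V \<in> \<V>"
    have xG: "x \<in> topspace T"
      using x HG by blast
    obtain W where W: "W \<in> \<V>" "\<forall>v\<in>W. rdiv (gminus x) (gminus (gminus v \<oplus> x)) \<in> V"
      using tame[OF V xG] by blast
    obtain w m where wm: "w \<in> W" "m \<in> N" "x = w \<oplus> m"
      using x W(1) by (auto simp: H_def set_gplus_def)
    have G: "w \<in> topspace T" "m \<in> topspace T"
      using wm VG(1)[OF W(1)] N(1) by auto
    then have "gminus w \<oplus> x = m"
      using wm(3) by (simp add: minus_add_cancel)
    then have "rdiv (gminus x) (gminus m) \<in> V"
      using W(2) wm(1) by auto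
    moreover have "rdiv (gminus x) (gminus m) \<oplus> gminus m = gminus x"
      using xG G by (intro rdiv_add) (auto simp: gminus_closed)
    ultimately show "gminus x \<in> V \<boxplus> N"
      using N(4)[OF wm(2)] unfolding set_gplus_def by (intro CollectI exI conjI) (auto intro: sym)
  qed
  ultimately show ?thesis
    using Hinv by (simp add: strong_sub_def H_def)
qed

text \<open>Closing one small neighbourhood under intersection, halving and the Lindelof sequences
  gives a countable family whose intersection modulo \<open>N\<close> is the desired
  \<open>H\<close>. Compactness then shows that the family is a neighbourhood base at
  \<open>\<zero>\<close> modulo \<open>H\<close>.\<close>

lemma admissible_with_countable_base:
  assumes "invariant_nhd U"
  obtains H \<V> where "admissible H" "H \<subseteq> U \<boxplus> N" "countable \<V>" "\<V> \<subseteq> Collect invariant_nhd"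
    "\<And>W. invariant_nhd W \<Longrightarrow> \<exists>V\<in>\<V>. V \<boxplus> V \<subseteq> W \<boxplus> H"
proof -
  obtain V0 where V0: "invariant_nhd V0"
    "\<And>A. closedin T A \<Longrightarrow> saturated A \<Longrightarrow> A \<subseteq> V0 \<boxplus> N \<Longrightarrow> compactin X (coset ` A)"
    by (rule compact_invariant_nhd) blast
  have N: "N \<subseteq> topspace T" "gyr_invariant N" "\<zero> \<in> N"
    using strong_sub_N strong_sub_subset by (auto simp: strong_sub_def)
  have UV0: "invariant_nhd (U \<inter> V0)"
    using assms V0 by (intro invariant_nhd_Int)
  obtain b where b: "invariant_nhd b" "b \<boxplus> b \<subseteq> U \<inter> V0"
    using invariant_nhd_half invariant_nhdD(1,2)[OF UV0] by metis
  obtain a where a: "invariant_nhd a" "a \<boxplus> a \<subseteq> b"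
    using invariant_nhd_half invariant_nhdD(1,2)[OF b(1)] by metis
  have bG: "b \<subseteq> topspace T" "\<zero> \<in> b" and aG: "a \<subseteq> topspace T" "\<zero> \<in> a"
    using invariant_nhdD a b by blast+
  have ab: "a \<subseteq> b"
    using subset_set_gplus[OF aG] a(2) by blast
  have bUV: "b \<subseteq> U \<inter> V0"
    using subset_set_gplus[OF bG] b(2) by blast
  have "\<exists>W. invariant_nhd W \<and> W \<boxplus> W \<subseteq> V" if "invariant_nhd V" for V
    using invariant_nhd_half invariant_nhdD(1,2)[OF that] by metis
  then obtain h where h: "\<And>V. invariant_nhd V \<Longrightarrow> invariant_nhd (h V) \<and> h V \<boxplus> h V \<subseteq> V"
    by metis
  obtain s :: "'a set \<Rightarrow> nat \<Rightarrow> 'a set" where s: "\<And>V. invariant_nhd V \<Longrightarrow> range (s V) \<subseteq> Collect invariant_nhd \<and>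
    (\<forall>y\<in>topspace T. \<exists>n. (y \<in> N \<longrightarrow> (\<forall>v\<in>s V n. y \<oplus> v \<in> V \<boxplus> N)) \<and>
       (\<forall>v\<in>s V n. rdiv (gminus y) (gminus (gminus v \<oplus> y)) \<in> V))"
    using invariant_nhd_sequence by metis
  \<comment> \<open>Three kinds of operation share one index: 0 for intersection, 1 for halving, and
    \<open>k + 2\<close> for entry \<open>k\<close> of the Lindelof sequence.\<close>
  define f where "f V W n = (case n of 0 \<Rightarrow> V \<inter> W | Suc 0 \<Rightarrow> h V | Suc (Suc k) \<Rightarrow> s V k)" for V W n
  have "f V W n \<in> Collect invariant_nhd"
    if "V \<in> Collect invariant_nhd" "W \<in> Collect invariant_nhd" for V W n
  proof -
    have "s V k \<in> Collect invariant_nhd" for k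
      using s[of V] that(1) by blast
    then show ?thesis
      using that h invariant_nhd_Int by (auto simp: f_def split: nat.split)
  qed
  then obtain \<V> where \<V>: "countable \<V>" "a \<in> \<V>" "\<V> \<subseteq> Collect invariant_nhd"
    "\<forall>V\<in>\<V>. \<forall>W\<in>\<V>. \<forall>n. f V W n \<in> \<V>"
    using countable_closure[of a "Collect invariant_nhd" f] a(1) by auto
  have inv: "invariant_nhd V" if "V \<in> \<V>" for V
    using that \<V>(3) by blast
  have Int: "V \<inter> W \<in> \<V>" if "V \<in> \<V>" "W \<in> \<V>" for V W
    using \<V>(4)[rule_format, OF that, of 0] by (simp add: f_def)
  have half: "\<exists>W\<in>\<V>. W \<boxplus> W \<subseteq> V" if "V \<in> \<V>" for V
    using \<V>(4)[rule_format, OF that that, of "Suc 0"] h[OF inv[OF that]] by (auto simp: f_def)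
  have sV: "s V n \<in> \<V>" if "V \<in> \<V>" for V n
    using \<V>(4)[rule_format, OF that that, of "Suc (Suc n)"] by (simp add: f_def)
  define H where "H = (\<Inter>V\<in>\<V>. V \<boxplus> N)"
  have H: "strong_sub H"
    unfolding H_def
  proof (rule strong_sub_Inter_set_gplus)
    fix V y assume *: "V \<in> \<V>" "y \<in> topspace T"
    show "\<exists>W\<in>\<V>. (y \<in> N \<longrightarrow> (\<forall>v\<in>W. y \<oplus> v \<in> V \<boxplus> N)) \<and>
       (\<forall>v\<in>W. rdiv (gminus y) (gminus (gminus v \<oplus> y)) \<in> V)"
      using s[OF inv[OF *(1)]] sV[OF *(1)] *(2) by blast
  qed (use \<V>(2) inv half in auto)
  have satu: "saturated (V \<boxplus> N)" "saturated (T closure_of (V \<boxplus> N))"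
    "V \<boxplus> N \<subseteq> T closure_of (V \<boxplus> N)" if "V \<in> \<V>" for V
  proof -
    show *: "saturated (V \<boxplus> N)"
      using invariant_nhdD(5)[OF inv[OF that]] strong_sub_N by (intro saturated_set_gplus) auto
    then show "saturated (T closure_of (V \<boxplus> N))"
      by (rule saturated_closure_of)
    show "V \<boxplus> N \<subseteq> T closure_of (V \<boxplus> N)"
      using * by (intro closure_of_subset) (simp add: saturated_def)
  qed
  \<comment> \<open>By halving, each \<open>V \<boxplus> N\<close> contains the closure of some
    other member \<open>W \<boxplus> N\<close>. Taking closures therefore does not enlarge the
    intersection, and \<open>H\<close> is closed.\<close>
  have Heq: "H = (\<Inter>V\<in>\<V>. T closure_of (V \<boxplus> N))"
  proof
    show "H \<subseteq> (\<Inter>V\<in>\<V>. T closure_of (V \<boxplus> N))"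
      using satu(3) by (auto simp: H_def)
    show "(\<Inter>V\<in>\<V>. T closure_of (V \<boxplus> N)) \<subseteq> H"
      unfolding H_def
    proof (rule INT_greatest)
      fix V assume "V \<in> \<V>"
      then obtain W where W: "W \<in> \<V>" "W \<boxplus> W \<subseteq> V"
        using half by blast
      then show "(\<Inter>V\<in>\<V>. T closure_of (V \<boxplus> N)) \<subseteq> V \<boxplus> N"
        using closure_of_set_gplus_half[OF inv[OF W(1)] strong_sub_N W(2)] by blast
    qed
  qed
  have Hcl: "closedin T H"
    unfolding Heq using \<V>(2) by (intro closedin_Inter) auto
  have NH: "N \<subseteq> H"
    unfolding H_def using subset_set_gplus_left[OF N(1)] invariant_nhdD(2)[OF inv] by (intro INT_greatest) auto
  have Ha: "H \<subseteq> a \<boxplus> N"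
    using \<V>(2) by (auto simp: H_def)
  \<comment> \<open>One halving pays for the closure, the other for absorbing \<open>H\<close> into
    \<open>b \<boxplus> N\<close>. The result lies in \<open>V0 \<boxplus> N\<close>, where closed
    saturated sets have compact images.\<close>
  have "T closure_of (a \<boxplus> H) \<subseteq> b \<boxplus> H"
    by (rule closure_of_set_gplus_half[OF a(1) H a(2)])
  also have "\<dots> \<subseteq> b \<boxplus> (b \<boxplus> N)"
    using Ha set_gplus_mono[OF ab order_refl, of N] by (intro set_gplus_mono) auto
  also have "\<dots> \<subseteq> (b \<boxplus> b) \<boxplus> N"
    by (rule set_gplus_assoc_subset[OF bG(1) bG(1) N(2)])
  also have "\<dots> \<subseteq> V0 \<boxplus> N"
    using b(2) by (intro set_gplus_mono) auto
  finally have "compactin X (coset ` (T closure_of (a \<boxplus> H)))"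
    using saturated_closure_of saturated_set_gplus[OF H NH aG(1)] by (intro V0(2)) auto
  then have adm: "admissible H"
    using H Hcl NH a(1) by (auto simp: admissible_def)
  have HU: "H \<subseteq> U \<boxplus> N"
    using Ha set_gplus_mono[of a U N N] ab bUV by blast
  have base: "\<exists>V\<in>\<V>. V \<boxplus> V \<subseteq> W \<boxplus> H" if W: "invariant_nhd W" for W
  proof -
    define C where "C = T closure_of (a \<boxplus> N)"
    have "C \<subseteq> b \<boxplus> N"
      unfolding C_def by (rule closure_of_set_gplus_half[OF a(1) strong_sub_N a(2)])
    also have "\<dots> \<subseteq> V0 \<boxplus> N"
      using bUV by (intro set_gplus_mono) auto
    finally have C: "compactin X (coset ` C)" "closedin T C" "saturated C"
      using satu(2)[OF \<V>(2)] by (auto simp: C_def intro!: V0(2))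
    note WD = invariant_nhdD[OF W]
    have WH: "openin T (W \<boxplus> H)" "saturated (W \<boxplus> H)"
      using openin_set_gplus[OF WD(1) H] saturated_set_gplus[OF H NH WD(5)] by auto
    have "C \<inter> (\<Inter>V\<in>\<V>. T closure_of (V \<boxplus> N)) \<subseteq> W \<boxplus> H"
      using subset_set_gplus_left[OF strong_sub_subset[OF H] WD(2)] Heq by blast
    moreover have "closedin T D \<and> saturated D" if "D \<in> (\<lambda>V. T closure_of (V \<boxplus> N)) ` \<V>" for D
      using that satu(2) by auto
    ultimately obtain \<F> where \<F>: "finite \<F>" "\<F> \<subseteq> (\<lambda>V. T closure_of (V \<boxplus> N)) ` \<V>"
      "C \<inter> \<Inter>\<F> \<subseteq> W \<boxplus> H"
      using compact_saturated_subfamily[OF C(2,3,1) _ WH] by metis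
    obtain \<Q> where \<Q>: "finite \<Q>" "\<Q> \<subseteq> \<V>" "\<F> = (\<lambda>V. T closure_of (V \<boxplus> N)) ` \<Q>"
      using finite_subset_image[OF \<F>(1,2)] by metis
    \<comment> \<open>The set \<open>a\<close> is kept in the intersection so that the half chosen
      next also lies in the compact piece \<open>C\<close>.\<close>
    have "a \<inter> \<Inter>\<Q> \<in> \<V>"
      using \<Q>(1,2)
    proof (induction \<Q>)
      case (insert Q \<Q>)
      then have "Q \<inter> (a \<inter> \<Inter>\<Q>) \<in> \<V>"
        using Int by simp
      then show ?case
        by (simp add: Int_left_commute)
    qed (use \<V>(2) in simp)
    then obtain V where V: "V \<in> \<V>" "V \<boxplus> V \<subseteq> a \<inter> \<Inter>\<Q>"
      using half by metis
    have sub: "A \<subseteq> T closure_of (A \<boxplus> N)" if "A \<in> \<V>" for A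
      using subset_set_gplus[OF _ N(3)] satu(3)[OF that] invariant_nhdD(5)[OF inv[OF that]] by blast
    have "V \<boxplus> V \<subseteq> C \<inter> \<Inter>\<F>"
    proof (intro Int_greatest Inter_greatest)
      show "V \<boxplus> V \<subseteq> C"
        using V(2) sub[OF \<V>(2)] by (auto simp: C_def)
      fix D assume "D \<in> \<F>"
      then obtain Q where "Q \<in> \<Q>" "D = T closure_of (Q \<boxplus> N)"
        unfolding \<Q>(3) by blast
      then show "V \<boxplus> V \<subseteq> D"
        using V(2) sub[of Q] \<Q>(2) by blast
    qed
    then show ?thesis
      using V(1) \<F>(3) by blast
  qed
  show thesis
    by (rule that[OF adm HU \<V>(1,3) base])
qed

text \<open>This is the second countability of the quotient by \<open>H\<close>, expressed in
  \<open>G\<close>. By the Lindelof property countably many translates of each member of the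
  countable base cover \<open>G\<close>, and a translate containing \<open>x\<close> lies in
  \<open>x\<close> plus twice that member.\<close>

lemma admissible_with_countable_family:
  assumes "invariant_nhd U"
  shows "\<exists>H B. admissible H \<and> H \<subseteq> U \<boxplus> N \<and> (\<forall>n::nat. openin T (B n)) \<and>
    (\<forall>x\<in>topspace T. \<forall>W. invariant_nhd W \<longrightarrow> (\<exists>n. x \<in> B n \<and> B n \<subseteq> (\<oplus>) x ` (W \<boxplus> H)))"
proof -
  obtain H \<V> where H: "admissible H" "H \<subseteq> U \<boxplus> N" "countable \<V>" "\<V> \<subseteq> Collect invariant_nhd"
    "\<And>W. invariant_nhd W \<Longrightarrow> \<exists>V\<in>\<V>. V \<boxplus> V \<subseteq> W \<boxplus> H"
    using admissible_with_countable_base[OF assms] by metis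
  have "\<exists>c. range c \<subseteq> topspace T \<and> (\<forall>y\<in>topspace T. \<exists>n::nat. y \<in> (\<oplus>) (c n) ` V)"
    if "V \<in> \<V>" for V
  proof (rule Lindelof_space_sequence[OF Lindelof])
    have V: "invariant_nhd V"
      using that H(4) by blast
    fix x assume x: "x \<in> topspace T"
    have "x \<in> (\<oplus>) x ` V"
      using x invariant_nhdD(2)[OF V] gzero_right by force
    then show "\<exists>A c. openin T A \<and> x \<in> A \<and> c \<in> topspace T \<and> (\<forall>y\<in>A. y \<in> (\<oplus>) c ` V)"
      using openin_translate[OF invariant_nhdD(1)[OF V] x] x by blast
  qed (use gzero_closed in blast)
  then obtain c where c: "\<And>V. V \<in> \<V> \<Longrightarrow> range (c V) \<subseteq> topspace T \<and>
      (\<forall>y\<in>topspace T. \<exists>n::nat. y \<in> (\<oplus>) (c V n) ` V)"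
    by metis
  define \<B> where "\<B> = (\<Union>V\<in>\<V>. range (\<lambda>n. (\<oplus>) (c V n) ` V))"
  have \<B>: "countable \<B>"
    using H(3) by (simp add: \<B>_def)
  have ex: "\<exists>A\<in>\<B>. x \<in> A \<and> A \<subseteq> (\<oplus>) x ` (W \<boxplus> H)" if x: "x \<in> topspace T" and W: "invariant_nhd W" for x W
  proof -
    obtain V where V: "V \<in> \<V>" "V \<boxplus> V \<subseteq> W \<boxplus> H"
      using H(5)[OF W] by blast
    then have Vinv: "invariant_nhd V"
      using H(4) by blast
    note VD = invariant_nhdD[OF Vinv]
    obtain n where n: "x \<in> (\<oplus>) (c V n) ` V"
      using c[OF V(1)] x by blast
    then obtain v where v: "v \<in> V" "x = c V n \<oplus> v"
      by blast
    have cG: "c V n \<in> topspace T" and vG: "v \<in> topspace T"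
      using c[OF V(1)] v VD(5) by auto
    \<comment> \<open>Right cancellation recovers the centre of the translate from \<open>x\<close>
      by adding an element of \<open>V\<close>.\<close>
    define v' where "v' = gyr (c V n) v (gminus v)"
    have v': "v' \<in> V" "c V n = x \<oplus> v'"
      using right_cancel[OF cG vG] gyr_invariantD[OF VD(4) cG vG VD(3)[OF v(1)]] v(2)
      by (auto simp: v'_def)
    have "(\<oplus>) (c V n) ` V \<subseteq> (\<oplus>) x ` (V \<boxplus> V)"
    proof safe
      fix u assume u: "u \<in> V"
      then obtain u' where "u' \<in> V" "(x \<oplus> v') \<oplus> u = x \<oplus> (v' \<oplus> u')"
        using gyr_invariant_assoc_left[OF VD(4) x _ u, of v'] v'(1) VD(5) by blast
      then show "c V n \<oplus> u \<in> (\<oplus>) x ` (V \<boxplus> V)"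
        using v' by (auto simp: set_gplus_def)
    qed
    also have "\<dots> \<subseteq> (\<oplus>) x ` (W \<boxplus> H)"
      using V(2) by (rule image_mono)
    finally have "(\<oplus>) (c V n) ` V \<subseteq> (\<oplus>) x ` (W \<boxplus> H)" .
    moreover have "(\<oplus>) (c V n) ` V \<in> \<B>"
      unfolding \<B>_def using V(1) by blast
    ultimately show ?thesis
      using n by (intro bexI[of _ "(\<oplus>) (c V n) ` V"] conjI)
  qed
  then have ne: "\<B> \<noteq> {}"
    using gzero_closed invariant_nhd_topspace by blast
  have op: "openin T A" if A: "A \<in> \<B>" for A
  proof -
    obtain V n where Vn: "V \<in> \<V>" "A = (\<oplus>) (c V n) ` V"
      using A unfolding \<B>_def by blast
    moreover have "c V n \<in> topspace T"
      using c[OF Vn(1)] by blast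
    ultimately show ?thesis
      using H(4) by (auto intro!: openin_translate dest: invariant_nhdD(1))
  qed
  define B where "B = from_nat_into \<B>"
  have "openin T (B n)" for n
    using op from_nat_into[OF ne] by (simp add: B_def)
  moreover have "\<exists>n. x \<in> B n \<and> B n \<subseteq> (\<oplus>) x ` (W \<boxplus> H)" if "x \<in> topspace T" "invariant_nhd W" for x W
    using ex[OF that] from_nat_into_surj[OF \<B>] by (metis B_def)
  ultimately show ?thesis
    using H(1,2) by blast
qed

end

section \<open>Weight and density\<close>

lemma closure_of_dense_Int:
  assumes "openin X V" "X closure_of D = topspace X"
  shows "V \<subseteq> X closure_of (V \<inter> D)"
proof -
  have "V \<inter> topspace X = V"
    using openin_subset[OF assms(1)] by blast
  then have "X closure_of (V \<inter> D) = X closure_of V"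
    using closure_of_openin_Int_closure_of[OF assms(1), of D] assms(2) by simp
  then show ?thesis
    using closure_of_subset[OF openin_subset[OF assms(1)]] by simp
qed

text \<open>Regular open sets form a base of a regular space and are determined by their traces
  on a dense set.\<close>

lemma weight_le_continuum_if_regular_separable:
  fixes X :: "'b topology"
  assumes "regular_space X" "separable_space X"
  shows "(weight X, continuum) \<in> ordLeq"
proof -
  obtain D where D: "countable D" "X closure_of D = topspace X"
    using assms(2) by (auto simp: separable_space_def)
  \<comment> \<open>The trace of an open \<open>V\<close> on \<open>D\<close> has the same closure
    as \<open>V\<close>, so subsets of \<open>D\<close> produce enough regular open sets for a
    base.\<close>
  define \<B> where "\<B> = (\<lambda>A. X interior_of (X closure_of A)) ` Pow D"
  have "\<exists>B. B \<in> \<B> \<and> x \<in> B \<and> B \<subseteq> U" if U: "openin X U" "x \<in> U" for U x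
  proof -
    obtain V C where VC: "openin X V" "closedin X C" "x \<in> V" "V \<subseteq> C" "C \<subseteq> U"
      using assms(1) U unfolding neighbourhood_base_of_closedin[symmetric] neighbourhood_base_of
      by metis
    have "X closure_of (V \<inter> D) \<subseteq> C"
      using VC(2,4) by (intro closure_of_minimal) auto
    then have "X interior_of (X closure_of (V \<inter> D)) \<subseteq> U"
      using VC(5) interior_of_subset by (metis subset_trans)
    moreover have "x \<in> X interior_of (X closure_of (V \<inter> D))"
      using closure_of_dense_Int[OF VC(1) D(2)] VC(1,3) interior_of_maximal by blast
    moreover have "X interior_of (X closure_of (V \<inter> D)) \<in> \<B>"
      unfolding \<B>_def by blast
    ultimately show ?thesis by blast
  qed
  moreover have "openin X B" if "B \<in> \<B>" for B
    using that by (auto simp: \<B>_def)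
  ultimately have "is_base X \<B>"
    unfolding is_base_def openin_topology_base_unique by blast
  moreover have "(card_of \<B>, card_of (Pow D)) \<in> ordLeq"
    unfolding \<B>_def by (rule card_of_image)
  moreover have "(card_of (Pow D), continuum) \<in> ordLeq"
    unfolding continuum_def
  proof (rule card_of_ordLeqI)
    \<comment> \<open>Enumerating \<open>D\<close> encodes its subsets as predicates on the natural
      numbers.\<close>
    show "inj_on (\<lambda>S n. n \<in> to_nat_on D ` S) (Pow D)"
    proof (rule inj_onI)
      fix S S' assume *: "S \<in> Pow D" "S' \<in> Pow D"
        "(\<lambda>n. n \<in> to_nat_on D ` S) = (\<lambda>n. n \<in> to_nat_on D ` S')"
      then have "to_nat_on D ` S = to_nat_on D ` S'"
        by (metis Collect_mem_eq)
      then show "S = S'"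
        using inj_on_image_eq_iff[OF inj_on_to_nat_on[OF D(1)]] * by blast
    qed
  qed auto
  ultimately show ?thesis
    using weight_ordLeq_iff ordLeq_transitive by metis
qed

text \<open>The countable dense subset of a power of a countable discrete space with at most
  continuum many factors (Hewitt, Marczewski, Pondiczery): functions that depend only on finitely
  many digits of the index.\<close>

lemma countable_finite_agreement:
  "\<exists>D :: ((nat \<Rightarrow> bool) \<Rightarrow> nat) set. countable D \<and> (\<forall>F a. finite F \<longrightarrow> (\<exists>d\<in>D. \<forall>t\<in>F. d t = a t))"
proof -
  \<comment> \<open>A code consists of a prefix length and a finite table from prefixes to values;
    indices whose prefix is missing from the table get 0.\<close>
  define val where "val p t = (case map_of (snd p) (map t [0..<fst p]) of Some k \<Rightarrow> k | None \<Rightarrow> 0)"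
    for p :: "nat \<times> (bool list \<times> nat) list" and t :: "nat \<Rightarrow> bool"
  have "\<exists>p. \<forall>t\<in>F. val p t = a t" if F: "finite F" for F a
  proof -
    \<comment> \<open>A common prefix length that separates the members of \<open>F\<close> makes
      their prefixes distinct keys.\<close>
    have "\<exists>k. \<forall>t\<in>F. \<forall>u\<in>F. t \<noteq> u \<longrightarrow> (\<exists>n<k. t n \<noteq> u n)"
    proof -
      have "\<forall>p\<in>F \<times> F. \<exists>n. fst p \<noteq> snd p \<longrightarrow> fst p n \<noteq> snd p n"
        by auto
      then obtain m where m: "\<forall>p\<in>F \<times> F. fst p \<noteq> snd p \<longrightarrow> fst p (m p) \<noteq> snd p (m p)"
        by metis
      \<comment> \<open>The maximum may itself be a separating position, so the strict bound is its
        successor.\<close>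
      have "\<exists>n<Suc (Max (m ` (F \<times> F))). t n \<noteq> u n" if "t \<in> F" "u \<in> F" "t \<noteq> u" for t u
      proof (intro exI conjI)
        show "m (t, u) < Suc (Max (m ` (F \<times> F)))"
          using F that by (simp add: le_imp_less_Suc)
        show "t (m (t, u)) \<noteq> u (m (t, u))"
          using m that by auto
      qed
      then show ?thesis
        by blast
    qed
    then obtain k where k: "\<And>t u. t \<in> F \<Longrightarrow> u \<in> F \<Longrightarrow> t \<noteq> u \<Longrightarrow> \<exists>n<k. t n \<noteq> u n"
      by metis
    obtain ts where ts: "set ts = F" "distinct ts"
      using finite_distinct_list[OF F] by metis
    define xs where "xs = map (\<lambda>t. (map t [0..<k], a t)) ts"
    have "inj_on (\<lambda>t. map t [0..<k]) F"
    proof (rule inj_onI, rule ccontr)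
      fix t u assume *: "t \<in> F" "u \<in> F" "map t [0..<k] = map u [0..<k]" "t \<noteq> u"
      then obtain n where "n < k" "t n \<noteq> u n"
        using k by blast
      then show False
        using *(3) by auto
    qed
    then have "distinct (map fst xs)"
      using ts by (simp add: xs_def o_def distinct_map)
    then have "map_of xs (map t [0..<k]) = Some (a t)" if "t \<in> F" for t
      using that ts(1) by (intro map_of_is_SomeI) (auto simp: xs_def)
    then have "\<forall>t\<in>F. val (k, xs) t = a t"
      by (simp add: val_def)
    then show ?thesis ..
  qed
  then show ?thesis
    by (intro exI[of _ "range val"]) (auto simp: countable_image)
qed

lemma finite_has_greatest:
  assumes "finite F" "F \<noteq> {}" "trans r" "total r"
  shows "\<exists>m\<in>F. \<forall>s\<in>F. s = m \<or> (s, m) \<in> r"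
  using assms(1,2)
proof (induction rule: finite_ne_induct)
  case (insert t F)
  then obtain m where m: "m \<in> F" "\<forall>s\<in>F. s = m \<or> (s, m) \<in> r"
    by blast
  show ?case
  proof (cases "t = m \<or> (t, m) \<in> r")
    case False
    then have "(m, t) \<in> r"
      using assms(4) by (metis UNIV_I total_on_def)
    have "s = t \<or> (s, t) \<in> r" if "s \<in> insert t F" for s
    proof -
      consider "s = t" | "s = m" | "(s, m) \<in> r"
        using m(2) \<open>s \<in> insert t F\<close> by blast
      then show ?thesis
        using \<open>(m, t) \<in> r\<close> transD[OF assms(3)] by cases auto
    qed
    then show ?thesis
      by blast
  qed (use m in auto)
qed auto

section \<open>Regularity of the coset space and intersections of cosets\<close>

context coset_space_setup
begin

text \<open>Translating by \<open>gminus x\<close> moves the problem to \<open>\<zero>\<close>.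
  There a halved neighbourhood \<open>V\<close> works, because the closure of
  \<open>V \<boxplus> N\<close> lies in \<open>(V \<boxplus> V) \<boxplus> N\<close>.\<close>

lemma regular_coset_space: "regular_space X"
  unfolding neighbourhood_base_of_closedin[symmetric] neighbourhood_base_of
proof safe
  fix W w assume W: "openin X W" and w: "w \<in> W"
  then obtain x where x: "x \<in> topspace T" "w = coset x"
    using openin_subset topspace_X by blast
  define P where "P = {x \<in> topspace T. coset x \<in> W}"
  define A where "A = {g \<in> topspace T. x \<oplus> g \<in> P}"
  have P: "openin T P" "saturated P"
    using coset_preimage[OF W] by (auto simp: P_def)
  have "openin T A"
    unfolding A_def using P x by (intro openin_continuous_map_preimage[where Y = T] gcont)
  moreover have "\<zero> \<in> A"
    using x w by (simp add: A_def P_def gzero_closed gzero_right)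
  ultimately obtain V where V: "invariant_nhd V" "V \<boxplus> V \<subseteq> A"
    by (rule invariant_nhd_half)
  note VD = invariant_nhdD[OF V(1)]
  have mx: "gminus x \<in> topspace T"
    using x gminus_closed by blast
  have sat: "saturated (V \<boxplus> N)"
    using VD(5) strong_sub_N by (intro saturated_set_gplus) auto
  define U where "U = {g \<in> topspace T. gminus x \<oplus> g \<in> V \<boxplus> N}"
  define C where "C = {g \<in> topspace T. gminus x \<oplus> g \<in> T closure_of (V \<boxplus> N)}"
  have U: "openin T U" "saturated U"
    unfolding U_def using openin_set_gplus[OF VD(1) strong_sub_N] mx sat
    by (auto intro!: openin_continuous_map_preimage[where Y = T] gcont saturated_translate)
  have C: "closedin T C" "saturated C"
    unfolding C_def using mx saturated_closure_of[OF sat]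
    by (auto intro!: closedin_continuous_map_preimage[where Y = T] gcont saturated_translate)
  have "V \<boxplus> N \<subseteq> T closure_of (V \<boxplus> N)"
    using sat by (intro closure_of_subset) (simp add: saturated_def)
  then have "U \<subseteq> C"
    by (auto simp: U_def C_def)
  have "C \<subseteq> P"
  proof
    fix g assume g: "g \<in> C"
    have "T closure_of (V \<boxplus> N) \<subseteq> A"
      using closure_of_set_gplus[OF V(1) strong_sub_N] V(2)
        saturated_set_gplus_subset[OF saturated_translate[OF P(2) x(1)]] unfolding A_def by blast
    then have "gminus x \<oplus> g \<in> A" "g \<in> topspace T"
      using g by (auto simp: C_def)
    then have "x \<oplus> (gminus x \<oplus> g) \<in> P"
      by (simp add: A_def)
    then show "g \<in> P"
      using x \<open>g \<in> topspace T\<close> by (simp add: add_minus_cancel)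
  qed
  have "x \<in> U"
    using x VD(2) subset_set_gplus[OF VD(5)] strong_sub_N by (auto simp: U_def gminus_left strong_sub_def)
  then have "w \<in> coset ` U"
    using x by blast
  moreover have "coset ` C \<subseteq> W"
    using \<open>C \<subseteq> P\<close> by (auto simp: P_def)
  ultimately show "\<exists>U V. openin X U \<and> closedin X V \<and> w \<in> U \<and> U \<subseteq> V \<and> V \<subseteq> W"
    using openin_coset_image[OF U] closedin_coset_image[OF C] image_mono[OF \<open>U \<subseteq> C\<close>]
    by (intro exI[of _ "coset ` U"] exI[of _ "coset ` C"] conjI)
qed

lemma minus_add_translate:
  "x \<in> topspace T \<Longrightarrow> A \<subseteq> topspace T \<Longrightarrow> p \<in> (\<oplus>) x ` A \<Longrightarrow> gminus x \<oplus> p \<in> A"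
  by (auto simp: minus_add_cancel subset_iff)

lemma translate_absorb:
  assumes "strong_sub H" "A \<subseteq> topspace T" "x \<in> topspace T" "y \<in> (\<oplus>) x ` (A \<boxplus> H)" "h \<in> H"
  shows "y \<oplus> h \<in> (\<oplus>) x ` (A \<boxplus> H)"
proof -
  obtain w where w: "w \<in> A \<boxplus> H" "y = x \<oplus> w"
    using assms(4) by blast
  then have "w \<in> topspace T"
    using set_gplus_closed[OF assms(2) strong_sub_subset[OF assms(1)]] by blast
  then obtain h' where h': "h' \<in> H" "y \<oplus> h = x \<oplus> (w \<oplus> h')"
    using gyr_invariant_assoc_left[OF strong_sub_invariant[OF assms(1)] assms(3) _ assms(5)] w(2)
    by metis
  then have "w \<oplus> h' \<in> (A \<boxplus> H) \<boxplus> H"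
    using w(1) unfolding set_gplus_def[of "A \<boxplus> H"] by blast
  then show ?thesis
    using strong_sub_absorb[OF assms(1,2)] h'(2) by blast
qed

text \<open>The intersection with \<open>topspace T\<close> makes an empty index set yield the whole
  gyrogroup.\<close>

lemma strong_sub_Inter:
  assumes "\<And>s. s \<in> S \<Longrightarrow> strong_sub (M s)"
  shows "strong_sub (topspace T \<inter> (\<Inter>s\<in>S. M s))"
proof -
  have "gyr_invariant (\<Inter>(insert (topspace T) (M ` S)))"
    using assms invariant_nhdD(4)[OF invariant_nhd_topspace] strong_sub_invariant
    by (intro gyr_invariant_Inter) auto
  moreover have "\<Inter>(insert (topspace T) (M ` S)) = topspace T \<inter> (\<Inter>s\<in>S. M s)"
    by simp
  ultimately show ?thesis
    using assms by (auto simp: strong_sub_def gzero_closed gplus_closed gminus_closed)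
qed

text \<open>The finite intersection property for cosets of admissible subgyrogroups; this is what
  carries the transfinite construction through limit stages.\<close>

lemma coset_Inter_nonempty:
  assumes adm: "\<And>s. s \<in> S \<Longrightarrow> admissible (M s)" and c: "\<And>s. s \<in> S \<Longrightarrow> c s \<in> topspace T"
    and fin: "\<And>F. finite F \<Longrightarrow> F \<subseteq> S \<Longrightarrow> \<exists>p\<in>topspace T. \<forall>s\<in>F. p \<in> (\<oplus>) (c s) ` M s"
  shows "\<exists>p\<in>topspace T. \<forall>s\<in>S. p \<in> (\<oplus>) (c s) ` M s"
proof (rule ccontr)
  assume none: "\<not> ?thesis"
  then obtain s0 where s0: "s0 \<in> S"
    using gzero_closed by blast
  define x where "x = c s0"
  have x: "x \<in> topspace T"
    using c s0 by (simp add: x_def)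
  have adm': "strong_sub (M s)" "closedin T (M s)" "N \<subseteq> M s" if "s \<in> S" for s
    using adm[OF that] by (auto simp: admissible_def)
  \<comment> \<open>Translation by \<open>x = c s0\<close> turns the coset with index
    \<open>s0\<close> into \<open>M s0\<close> itself, whose image in \<open>X\<close> is
    compact.\<close>
  define A where "A s = {g \<in> topspace T. x \<oplus> g \<in> (\<oplus>) (c s) ` M s}" for s
  have A: "closedin T (A s)" "saturated (A s)" if "s \<in> S" for s
    unfolding A_def using that x c adm' closedin_coset saturated_coset
    by (auto intro!: closedin_continuous_map_preimage[where Y = T] gcont saturated_translate)
  have As0: "A s0 = M s0"
    using coset_iff[OF adm'(1)[OF s0] x] x strong_sub_subset[OF adm'(1)[OF s0]]
    by (auto simp: A_def minus_add_cancel gplus_closed x_def[symmetric])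
  obtain V where V: "invariant_nhd V" "compactin X (coset ` (T closure_of (V \<boxplus> M s0)))"
    using adm[OF s0] by (auto simp: admissible_def)
  have "M s0 \<subseteq> V \<boxplus> M s0"
    using subset_set_gplus_left[OF strong_sub_subset[OF adm'(1)[OF s0]] invariant_nhdD(2)[OF V(1)]] .
  also have "\<dots> \<subseteq> T closure_of (V \<boxplus> M s0)"
    using set_gplus_closed invariant_nhdD(5)[OF V(1)] strong_sub_subset[OF adm'(1)[OF s0]]
    by (intro closure_of_subset) auto
  finally have compact: "compactin X (coset ` A s0)"
    using compactin_coset_image_subset[OF V(2) A[OF s0]] As0 by simp
  have "A s0 \<inter> \<Inter>(A ` S) \<subseteq> {}"
  proof
    fix g assume g: "g \<in> A s0 \<inter> \<Inter>(A ` S)"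
    then have "x \<oplus> g \<in> topspace T"
      using x by (auto simp: A_def gplus_closed)
    moreover have "\<forall>s\<in>S. x \<oplus> g \<in> (\<oplus>) (c s) ` M s"
      using g by (auto simp: A_def)
    ultimately show "g \<in> {}"
      using none by blast
  qed
  moreover have "closedin T D \<and> saturated D" if "D \<in> A ` S" for D
    using that A by auto
  moreover have "openin T {}" "saturated {}"
    by (auto simp: saturated_def)
  ultimately obtain \<F> where \<F>: "finite \<F>" "\<F> \<subseteq> A ` S" "A s0 \<inter> \<Inter>\<F> \<subseteq> {}"
    using compact_saturated_subfamily[OF A[OF s0] compact] by metis
  obtain F where F: "finite F" "F \<subseteq> S" "\<F> = A ` F"
    using finite_subset_image[OF \<F>(1,2)] by metis
  obtain p where p: "p \<in> topspace T" "\<forall>s\<in>insert s0 F. p \<in> (\<oplus>) (c s) ` M s"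
    using fin[of "insert s0 F"] F s0 by auto
  have "gminus x \<oplus> p \<in> A s" if "s \<in> insert s0 F" for s
  proof -
    have "p \<in> (\<oplus>) (c s) ` M s"
      using p(2) that by blast
    then show ?thesis
      using p(1) x by (simp add: A_def add_minus_cancel gplus_closed gminus_closed)
  qed
  then show False
    using \<F>(3) F(3) by blast
qed

end

section \<open>Guided transfinite choices\<close>

locale admissible_family = coset_space_setup +
  fixes r :: "('i \<times> 'i) set" and M :: "'i \<Rightarrow> 'a set" and B :: "'i \<Rightarrow> nat \<Rightarrow> 'a set"
  assumes r: "wf r" "trans r" "total r"
    and admissible_M: "admissible (M t)"
    and openin_B: "openin T (B t n)"
    and B_base: "x \<in> topspace T \<Longrightarrow> invariant_nhd W \<Longrightarrow>
      \<exists>n. x \<in> B t n \<and> B t n \<subseteq> (\<oplus>) x ` (W \<boxplus> M t)"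
begin

text \<open>For \<open>c\<close> with values in the carrier this is empty or a left coset of the
  intersection of the \<open>M s\<close> with \<open>s \<in> S\<close>. For \<open>S = UNIV\<close>
  its elements are the final points of the construction.\<close>

definition below :: "('i \<Rightarrow> 'a) \<Rightarrow> 'i set \<Rightarrow> 'a set" where
  "below c S = {p \<in> topspace T. \<forall>s\<in>S. p \<in> (\<oplus>) (c s) ` M s}"

definition guided :: "('i \<Rightarrow> nat) \<Rightarrow> ('i \<Rightarrow> 'a) \<Rightarrow> bool" where
  "guided z c \<longleftrightarrow> (\<forall>t. c t \<in> below c {s. (s, t) \<in> r} \<and>
     (below c {s. (s, t) \<in> r} \<inter> B t (z t) \<noteq> {} \<longrightarrow> c t \<in> B t (z t)))"

lemma M_props: "strong_sub (M t)" "closedin T (M t)" "N \<subseteq> M t"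
  using admissible_M by (auto simp: admissible_def)

text \<open>For finitely many indices the choice at the greatest one lies in all the cosets
  concerned; compactness extends this to arbitrary \<open>S\<close>.\<close>

lemma below_nonempty:
  assumes "\<And>s. s \<in> S \<Longrightarrow> c s \<in> below c {u. (u, s) \<in> r}"
  shows "below c S \<noteq> {}"
proof -
  have c: "c s \<in> topspace T" if "s \<in> S" for s
    using assms[OF that] by (simp add: below_def)
  have "\<exists>p\<in>topspace T. \<forall>s\<in>S. p \<in> (\<oplus>) (c s) ` M s"
  proof (rule coset_Inter_nonempty[OF admissible_M c])
    fix F assume F: "finite F" "F \<subseteq> S"
    show "\<exists>p\<in>topspace T. \<forall>s\<in>F. p \<in> (\<oplus>) (c s) ` M s"
    proof (cases "F = {}")
      case False
      then obtain m where m: "m \<in> F" "\<forall>s\<in>F. s = m \<or> (s, m) \<in> r"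
        using finite_has_greatest[OF F(1) False r(2,3)] by blast
      have cm: "c m \<in> below c {u. (u, m) \<in> r}"
        using assms m F by blast
      have "c m \<in> (\<oplus>) (c s) ` M s" if "s \<in> F" for s
        using m(2) that cm self_in_coset[OF M_props(1), of "c m" m] by (auto simp: below_def)
      then show ?thesis
        using cm by (auto simp: below_def)
    qed (use gzero_closed in auto)
  qed
  then show ?thesis
    by (auto simp: below_def)
qed

text \<open>Well-founded dependent choice applies because the condition at \<open>t\<close> consults
  only earlier values and can be met whenever these were chosen correctly.\<close>

lemma guided_exists: "\<exists>c. guided z c"
  unfolding guided_def
proof (rule dependent_wf_choice[OF r(1)])
  fix f g :: "'i \<Rightarrow> 'a" and t y assume "\<And>s. (s, t) \<in> r \<Longrightarrow> f s = g s"
  then have "below f {s. (s, t) \<in> r} = below g {s. (s, t) \<in> r}"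
    by (auto simp: below_def)
  then show "(y \<in> below f {s. (s, t) \<in> r} \<and>
      (below f {s. (s, t) \<in> r} \<inter> B t (z t) \<noteq> {} \<longrightarrow> y \<in> B t (z t))) =
    (y \<in> below g {s. (s, t) \<in> r} \<and>
      (below g {s. (s, t) \<in> r} \<inter> B t (z t) \<noteq> {} \<longrightarrow> y \<in> B t (z t)))"
    by simp
next
  fix t and f :: "'i \<Rightarrow> 'a"
  assume "\<And>s. (s, t) \<in> r \<Longrightarrow> f s \<in> below f {u. (u, s) \<in> r} \<and>
      (below f {u. (u, s) \<in> r} \<inter> B s (z s) \<noteq> {} \<longrightarrow> f s \<in> B s (z s))"
  then have "below f {s. (s, t) \<in> r} \<noteq> {}"
    by (intro below_nonempty) blast
  then show "\<exists>y. y \<in> below f {s. (s, t) \<in> r} \<and>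
      (below f {s. (s, t) \<in> r} \<inter> B t (z t) \<noteq> {} \<longrightarrow> y \<in> B t (z t))"
    by blast
qed

section \<open>Finite conditions that determine the position of the final point\<close>

text \<open>The restriction of \<open>a\<close> to \<open>F\<close> acts like a condition in
  forcing. Guided choices are not unique for a given guide, so all of them are taken into
  account.\<close>

definition forces :: "'i set \<Rightarrow> ('i \<Rightarrow> nat) \<Rightarrow> 'a set \<Rightarrow> bool" where
  "forces F a A \<longleftrightarrow> (\<forall>z c. (\<forall>s\<in>F. z s = a s) \<longrightarrow> guided z c \<longrightarrow> below c UNIV \<subseteq> A)"

text \<open>Induction on a bound \<open>t\<close> of \<open>F\<close>. If \<open>t \<in> F\<close>,
  earlier indices force the final point close to \<open>x\<close> modulo the intersection of the
  earlier \<open>M s\<close>; then the earlier coset meets a basic set \<open>B t n\<close> near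
  \<open>x\<close>, and a guide with value \<open>n\<close> at \<open>t\<close> makes the choice at
  \<open>t\<close> fall into it.\<close>

lemma forces_neighbourhood:
  fixes F :: "'i set"
  assumes "finite F" "\<forall>s\<in>F. s = t \<or> (s, t) \<in> r" "x \<in> topspace T" "invariant_nhd V"
  shows "\<exists>F' a. finite F' \<and> (\<forall>s\<in>F'. s = t \<or> (s, t) \<in> r) \<and>
    forces F' a (\<Inter>s\<in>F. (\<oplus>) x ` (V \<boxplus> M s))"
  using assms
proof (induction t arbitrary: F V rule: wf_induct_rule[OF r(1)])
  case (1 t)
  \<comment> \<open>When all indices are strictly earlier, the induction hypothesis at the greatest
    of them applies.\<close>
  have smaller: "\<exists>F' a. finite F' \<and> (\<forall>s\<in>F'. (s, t) \<in> r) \<and>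
      forces F' a (\<Inter>s\<in>F. (\<oplus>) x ` (V \<boxplus> M s))"
    if F: "finite F" "\<forall>s\<in>F. (s, t) \<in> r" and V: "invariant_nhd V" for F V
  proof (cases "F = {}")
    \<comment> \<open>The empty intersection is the whole type, so the empty condition forces
      it.\<close>
    case True
    then show ?thesis
      by (intro exI[of _ "{}"]) (simp add: forces_def)
  next
    case False
    then obtain m where m: "m \<in> F" "\<forall>s\<in>F. s = m \<or> (s, m) \<in> r"
      using finite_has_greatest[OF F(1) False r(2,3)] by blast
    then have mt: "(m, t) \<in> r"
      using F by blast
    obtain F' a where *: "finite F'" "\<forall>s\<in>F'. s = m \<or> (s, m) \<in> r"
      "forces F' a (\<Inter>s\<in>F. (\<oplus>) x ` (V \<boxplus> M s))"
      using 1(1)[OF mt F(1) m(2) 1(4) V] by metis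
    have "\<forall>s\<in>F'. (s, t) \<in> r"
    proof
      fix s assume "s \<in> F'"
      then consider "s = m" | "(s, m) \<in> r"
        using *(2) by blast
      then show "(s, t) \<in> r"
        using mt transD[OF r(2)] by cases auto
    qed
    then show ?thesis
      using * by blast
  qed
  have Vn: "openin T V" "\<zero> \<in> V" "V \<subseteq> topspace T"
    using invariant_nhdD[OF 1(5)] by auto
  show ?case
  proof (cases "t \<in> F")
    case False
    then have "\<forall>s\<in>F. (s, t) \<in> r"
      using 1(3) by metis
    then show ?thesis
      using smaller[OF 1(2) _ 1(5)] by blast
  next
    case True
    define S where "S = {s. (s, t) \<in> r}"
    have FS: "s \<in> S" if "s \<in> F" "s \<noteq> t" for s
      using 1(3) that by (auto simp: S_def)
    obtain n where n: "x \<in> B t n" "B t n \<subseteq> (\<oplus>) x ` (V \<boxplus> M t)"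
      using B_base[OF 1(4,5)] by blast
    \<comment> \<open>Points of \<open>E\<close> lie in the basic set at \<open>t\<close> and also
      meet the requirements at the remaining indices of \<open>F\<close>.\<close>
    define E where "E = B t n \<inter> \<Inter>((\<lambda>s. (\<oplus>) x ` (V \<boxplus> M s)) ` (F - {t}))"
    have "openin T ((\<oplus>) x ` (V \<boxplus> M s))" for s
      using openin_translate[OF openin_set_gplus[OF Vn(1) M_props(1)] 1(4)] .
    then have openE: "openin T E"
      using 1(2) openin_B unfolding E_def
      by (intro openin_Int_Inter) auto
    have "\<zero> \<in> V \<boxplus> M s" for s
      using subset_set_gplus_left[OF strong_sub_subset[OF M_props(1)] Vn(2)] M_props(1)[of s]
      by (auto simp: strong_sub_def)
    then have "x \<in> (\<oplus>) x ` (V \<boxplus> M s)" for s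
      using gzero_right[OF 1(4)] by (metis image_eqI)
    then have xE: "x \<in> E"
      using n(1) by (simp add: E_def)
    define H where "H = topspace T \<inter> (\<Inter>s\<in>S. M s)"
    have H: "strong_sub H" "N \<subseteq> H"
      unfolding H_def
      by (intro strong_sub_Inter M_props(1), intro Int_greatest INT_greatest M_props(3)
          strong_sub_subset[OF strong_sub_N])
    have EG: "E \<subseteq> topspace T"
      using openin_subset[OF openE] .
    \<comment> \<open>Translation turns \<open>E \<boxplus> H\<close> into a saturated open set
      containing \<open>H\<close>, so by \<open>admissible_Inter_subset\<close> finitely many
      earlier indices control it.\<close>
    define A where "A = {g \<in> topspace T. x \<oplus> g \<in> E \<boxplus> H}"
    have "openin T A" "saturated A"
      unfolding A_def using openin_set_gplus[OF openE H(1)] saturated_set_gplus[OF H EG] 1(4)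
      by (auto intro!: openin_continuous_map_preimage[where Y = T] gcont saturated_translate)
    moreover have "topspace T \<inter> (\<Inter>s\<in>S. M s) \<subseteq> A"
    proof
      fix h assume "h \<in> topspace T \<inter> (\<Inter>s\<in>S. M s)"
      then have "h \<in> H" "h \<in> topspace T"
        by (auto simp: H_def)
      then show "h \<in> A"
        using xE by (auto simp: A_def set_gplus_def)
    qed
    ultimately obtain F2 V2 where F2: "finite F2" "F2 \<subseteq> S" "invariant_nhd V2"
      "topspace T \<inter> (\<Inter>s\<in>F2. V2 \<boxplus> M s) \<subseteq> A"
      using admissible_Inter_subset[of S M A] admissible_M by metis
    obtain F' a where F': "finite F'" "\<forall>s\<in>F'. (s, t) \<in> r"
      "forces F' a (\<Inter>s\<in>F2. (\<oplus>) x ` (V2 \<boxplus> M s))"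
      using smaller[OF F2(1) _ F2(3)] F2(2) unfolding S_def by blast
    have tF': "t \<notin> F'"
      using F'(2) wf_not_refl[OF r(1)] by blast
    have "p \<in> (\<Inter>s\<in>F. (\<oplus>) x ` (V \<boxplus> M s))"
      if z: "\<forall>s\<in>insert t F'. z s = (a(t := n)) s" and c: "guided z c" and p: "p \<in> below c UNIV" for z c p
    proof
      fix s assume s: "s \<in> F"
      have pG: "p \<in> topspace T"
        using p by (simp add: below_def)
      have cG: "c u \<in> topspace T" for u
        using c by (simp add: guided_def below_def)
      have "z s = a s" if "s \<in> F'" for s
        using z that tF' by (metis fun_upd_other insertCI)
      then have "p \<in> (\<oplus>) x ` (V2 \<boxplus> M s)" if "s \<in> F2" for s
        using F'(3) c p that unfolding forces_def by (meson INT_E subsetD)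
      then have "gminus x \<oplus> p \<in> V2 \<boxplus> M s" if "s \<in> F2" for s
        using that 1(4) invariant_nhdD(5)[OF F2(3)] strong_sub_subset[OF M_props(1)]
        by (intro minus_add_translate set_gplus_closed)
      then have "gminus x \<oplus> p \<in> A"
        using F2(4) pG 1(4) by (auto simp: gplus_closed gminus_closed)
      then have "p \<in> E \<boxplus> H"
        using 1(4) pG by (simp add: A_def add_minus_cancel)
      then obtain y h where yh: "y \<in> E" "h \<in> H" "p = y \<oplus> h"
        by (auto simp: set_gplus_def)
      have yG: "y \<in> topspace T"
        using yh EG by blast
      \<comment> \<open>Since \<open>y\<close> and \<open>p\<close> differ by an element of
        \<open>H\<close>, \<open>y\<close> lies in every earlier coset. It therefore witnesses that
        the set available at stage \<open>t\<close> meets \<open>B t (z t)\<close>.\<close>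
      obtain h' where h': "h' \<in> H" "y = p \<oplus> h'"
        using coset_sym[OF H(1) yG, of p] yh by blast
      have "y \<in> (\<oplus>) (c u) ` M u" if "u \<in> S" for u
      proof -
        have "p \<in> (\<oplus>) (c u) ` M u" "h' \<in> M u"
          using p h'(1) that by (auto simp: below_def H_def)
        then show ?thesis
          using coset_absorb[OF M_props(1) cG] h'(2) by simp
      qed
      then have "y \<in> below c {s. (s, t) \<in> r} \<inter> B t (z t)"
        using yG yh(1) z by (auto simp: below_def S_def E_def)
      then have "c t \<in> B t (z t)"
        using c unfolding guided_def by blast
      then have ct: "c t \<in> (\<oplus>) x ` (V \<boxplus> M t)"
        using n(2) z by auto
      \<comment> \<open>At \<open>s = t\<close> the point \<open>p\<close> is in the same coset of
        \<open>M t\<close> as \<open>c t\<close>. At an earlier \<open>s\<close> it is in the same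
        coset of \<open>M s\<close> as \<open>y\<close>.\<close>
      show "p \<in> (\<oplus>) x ` (V \<boxplus> M s)"
      proof (cases "s = t")
        case True
        obtain k where "k \<in> M t" "p = c t \<oplus> k"
          using p by (auto simp: below_def)
        then show ?thesis
          using translate_absorb[OF M_props(1) Vn(3) 1(4) ct] True by simp
      next
        case False
        then have "y \<in> (\<oplus>) x ` (V \<boxplus> M s)" "h \<in> M s"
          using yh s FS by (auto simp: E_def H_def)
        then show ?thesis
          using translate_absorb[OF M_props(1) Vn(3) 1(4)] yh(3) by simp
      qed
    qed
    then have "forces (insert t F') (a(t := n)) (\<Inter>s\<in>F. (\<oplus>) x ` (V \<boxplus> M s))"
      unfolding forces_def by blast
    moreover have "\<forall>s\<in>insert t F'. s = t \<or> (s, t) \<in> r"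
      using F'(2) by blast
    moreover have "finite (insert t F')"
      using F'(1) by simp
    ultimately show ?thesis
      by blast
  qed
qed

text \<open>The cosets of the final points with guides in \<open>D\<close> are dense: every nonempty
  open set is forced by some finite condition, and some member of \<open>D\<close> satisfies that
  condition.\<close>

lemma separable_coset_space:
  fixes D :: "('i \<Rightarrow> nat) set"
  assumes "(\<Inter>t. M t) \<subseteq> N" "countable D"
    and D: "\<And>F a. finite F \<Longrightarrow> \<exists>d\<in>D. \<forall>t\<in>F. d t = a t"
  shows "separable_space X"
proof -
  obtain c where c: "\<And>z. guided z (c z)"
    using guided_exists by metis
  have "below (c z) UNIV \<noteq> {}" for z
    using c by (intro below_nonempty) (simp add: guided_def)
  then have "\<forall>z. \<exists>p. p \<in> below (c z) UNIV"
    by blast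
  then obtain g where g: "\<And>z. g z \<in> below (c z) UNIV"
    by metis
  have gG: "g z \<in> topspace T" for z
    using g by (auto simp: below_def)
  have "\<exists>d\<in>D. coset (g d) \<in> W" if W: "openin X W" "w \<in> W" for W w
  proof -
    obtain x where x: "x \<in> topspace T" "w = coset x"
      using W openin_subset topspace_X by blast
    define P where "P = {x \<in> topspace T. coset x \<in> W}"
    have P: "openin T P" "saturated P" "x \<in> P"
      using coset_preimage[OF W(1)] x W(2) by (auto simp: P_def)
    define A where "A = {g \<in> topspace T. x \<oplus> g \<in> P}"
    have "openin T A" "saturated A"
      unfolding A_def using P x
      by (auto intro!: openin_continuous_map_preimage[where Y = T] gcont saturated_translate)
    \<comment> \<open>The saturated set \<open>P\<close> contains \<open>x\<close> and hence
      \<open>x \<oplus> n\<close> for every \<open>n\<close> in \<open>N\<close>, in which the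
      intersection of all \<open>M t\<close> is contained.\<close>
    moreover have "topspace T \<inter> (\<Inter>t\<in>UNIV. M t) \<subseteq> A"
      using assms(1) P(2,3) by (auto simp: A_def saturated_def)
    ultimately obtain F V where F: "finite F" "invariant_nhd V" "topspace T \<inter> (\<Inter>t\<in>F. V \<boxplus> M t) \<subseteq> A"
      using admissible_Inter_subset[of UNIV M A] admissible_M by metis
    have "\<exists>F' a. finite F' \<and> forces F' a (\<Inter>s\<in>F. (\<oplus>) x ` (V \<boxplus> M s))"
    proof (cases "F = {}")
      case True
      then show ?thesis
        by (intro exI[of _ "{}"]) (simp add: forces_def)
    next
      case False
      then obtain m where m: "\<forall>s\<in>F. s = m \<or> (s, m) \<in> r"
        using finite_has_greatest[OF F(1) False r(2,3)] by blast
      show ?thesis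
        using forces_neighbourhood[OF F(1) m x(1) F(2)] by blast
    qed
    then obtain F' a where F': "finite F'" "forces F' a (\<Inter>s\<in>F. (\<oplus>) x ` (V \<boxplus> M s))"
      by metis
    obtain d where d: "d \<in> D" "\<forall>t\<in>F'. d t = a t"
      using D[OF F'(1)] by blast
    have "g d \<in> (\<Inter>s\<in>F. (\<oplus>) x ` (V \<boxplus> M s))"
      using F'(2) d(2) c g unfolding forces_def by blast
    then have "gminus x \<oplus> g d \<in> V \<boxplus> M s" if "s \<in> F" for s
      using that x(1) invariant_nhdD(5)[OF F(2)] strong_sub_subset[OF M_props(1)]
      by (intro minus_add_translate set_gplus_closed) auto
    then have "gminus x \<oplus> g d \<in> A"
      using F(3) gG x(1) by (auto simp: gplus_closed gminus_closed)
    then have "g d \<in> P"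
      using x(1) gG by (simp add: A_def add_minus_cancel)
    then show ?thesis
      using d(1) by (auto simp: P_def)
  qed
  then have "coset ` g ` D \<inter> W \<noteq> {}" if "openin X W" "W \<noteq> {}" for W
    using that by (metis disjoint_iff ex_in_conv imageI)
  then have "X closure_of (coset ` g ` D) = topspace X"
    by (simp add: dense_intersects_open)
  moreover have "coset ` g ` D \<subseteq> topspace X"
    using gG by (auto simp: topspace_X)
  ultimately show ?thesis
    unfolding separable_space_def using assms(2) by blast
qed

end

section \<open>From small weight to separability\<close>

context Lindelof_coset_space
begin

text \<open>Only the base members around the coset of \<open>\<zero>\<close> are indexed. Choosing
  \<open>M t\<close> inside the preimage of the member with index \<open>t\<close> makes the
  \<open>M t\<close> intersect in \<open>N\<close>, because cosets of \<open>N\<close> are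
  closed.\<close>

lemma separable_if_weight_le_continuum:
  assumes "(weight X, continuum) \<in> ordLeq"
  shows "separable_space X"
proof -
  obtain \<B> where \<B>: "is_base X \<B>" "(card_of \<B>, continuum) \<in> ordLeq"
    using assms weight_ordLeq_iff by metis
  define \<B>0 where "\<B>0 = {W \<in> \<B>. coset \<zero> \<in> W}"
  have base: "\<And>V. V \<in> \<B> \<Longrightarrow> openin X V"
    "\<And>U x. openin X U \<Longrightarrow> x \<in> U \<Longrightarrow> \<exists>V. V \<in> \<B> \<and> x \<in> V \<and> V \<subseteq> U"
    using \<B>(1) unfolding is_base_def openin_topology_base_unique by auto
  have "coset \<zero> \<in> topspace X"
    by (simp add: topspace_X gzero_closed)
  then have ne: "\<B>0 \<noteq> {}"
    using base(2)[OF openin_topspace] by (auto simp: \<B>0_def)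
  have "(card_of \<B>0, card_of \<B>) \<in> ordLeq"
    by (rule card_of_mono1) (auto simp: \<B>0_def)
  then have "(card_of \<B>0, card_of (UNIV :: (nat \<Rightarrow> bool) set)) \<in> ordLeq"
    using \<B>(2) ordLeq_transitive unfolding continuum_def by blast
  then obtain e :: "(nat \<Rightarrow> bool) \<Rightarrow> 'a set set" where e: "range e = \<B>0"
    using card_of_ordLeq2[OF ne] by metis
  define good where "good t M B \<longleftrightarrow> admissible M \<and> M \<subseteq> {x \<in> topspace T. coset x \<in> e t} \<and>
    (\<forall>n::nat. openin T (B n)) \<and>
    (\<forall>x\<in>topspace T. \<forall>W. invariant_nhd W \<longrightarrow> (\<exists>n. x \<in> B n \<and> B n \<subseteq> (\<oplus>) x ` (W \<boxplus> M)))"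
    for t M B
  have "\<exists>M B. good t M B" for t
  proof -
    have et: "openin X (e t)" "coset \<zero> \<in> e t"
      using e base(1) by (auto simp: \<B>0_def)
    define P where "P = {x \<in> topspace T. coset x \<in> e t}"
    have "openin T P" "saturated P" "\<zero> \<in> P"
      using coset_preimage[OF et(1)] et(2) by (auto simp: P_def gzero_closed)
    moreover then obtain U where U: "invariant_nhd U" "U \<subseteq> P"
      using invariant_nhd_exists by metis
    ultimately have "U \<boxplus> N \<subseteq> P"
      using saturated_set_gplus_subset by blast
    then show ?thesis
      using admissible_with_countable_family[OF U(1)] unfolding P_def good_def by (meson subset_trans)
  qed
  then obtain M B where "\<And>t. good t (M t) (B t)"
    by metis
  then have MB: "\<And>t. admissible (M t)" "\<And>t. M t \<subseteq> {x \<in> topspace T. coset x \<in> e t}"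
    "\<And>t n. openin T (B t (n::nat))"
    "\<And>t x W. x \<in> topspace T \<Longrightarrow> invariant_nhd W \<Longrightarrow> \<exists>n. x \<in> B t n \<and> B t n \<subseteq> (\<oplus>) x ` (W \<boxplus> M t)"
    unfolding good_def by blast+
  \<comment> \<open>An arbitrary well-order of the index type drives the construction; its strict
    part \<open>w - Id\<close> serves as the relation of the locale.\<close>
  obtain w :: "(nat \<Rightarrow> bool) rel" where w: "well_order_on UNIV w"
    using well_order_on by blast
  have w': "wf (w - Id)" "trans (w - Id)" "total (w - Id)"
    using w by (auto simp: well_order_on_def linear_order_on_def partial_order_on_def
        preorder_on_def intro: trans_diff_Id)
  interpret admissible_family T "(\<oplus>)" "\<zero>" gminus gyr N "w - Id" M B
  proof (intro admissible_family.intro coset_space_setup_axioms admissible_family_axioms.intro)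
    show "\<exists>n. x \<in> B t n \<and> B t n \<subseteq> (\<oplus>) x ` (W \<boxplus> M t)"
      if "x \<in> topspace T" "invariant_nhd W" for x W t
      using that by (rule MB(4))
  qed (rule w' MB(1,3))+
  have "(\<Inter>t. M t) \<subseteq> N"
  proof
    fix x assume x: "x \<in> (\<Inter>t. M t)"
    then have xG: "x \<in> topspace T"
      using MB(2) by blast
    show "x \<in> N"
    proof (rule ccontr)
      assume "x \<notin> N"
      \<comment> \<open>For \<open>x\<close> outside \<open>N\<close> the complement of its coset is
        a saturated open set containing \<open>\<zero>\<close>, so some base member around the coset
        of \<open>\<zero>\<close> misses the coset of \<open>x\<close>.\<close>
      define P where "P = topspace T - coset x"
      have P: "openin T P" "saturated P"
        unfolding P_def coset_def
        using closedin_coset[OF closedin_N strong_sub_N xG] saturated_coset[OF strong_sub_N _ xG]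
          saturated_Diff by auto
      have "\<zero> \<notin> coset x"
        using coset_sym[OF strong_sub_N xG, of "\<zero>"] \<open>x \<notin> N\<close> strong_sub_subset[OF strong_sub_N]
        by (auto simp: coset_def gzero_left subset_iff)
      then have "coset \<zero> \<in> coset ` P"
        by (simp add: P_def gzero_closed)
      then obtain W where W: "W \<in> \<B>" "coset \<zero> \<in> W" "W \<subseteq> coset ` P"
        using base(2)[OF openin_coset_image[OF P]] by metis
      then have "W \<in> range e"
        unfolding e \<B>0_def by blast
      then obtain t where "W = e t"
        by (rule rangeE)
      then have "coset x \<in> coset ` P"
        using W(3) x MB(2)[of t] by auto
      then have "x \<in> P"
        using coset_mem_image[OF P(2) xG] by simp
      then show False
        using self_in_coset[OF strong_sub_N xG] by (simp add: P_def coset_def)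
    qed
  qed
  moreover obtain D :: "((nat \<Rightarrow> bool) \<Rightarrow> nat) set" where "countable D"
    "\<forall>F a. finite F \<longrightarrow> (\<exists>d\<in>D. \<forall>t\<in>F. d t = a t)"
    using countable_finite_agreement by blast
  ultimately show ?thesis
    using separable_coset_space by blast
qed

end

theorem theorem4p6:
  fixes \<L> :: "'a topology set"
    and T :: "'a topology"
    and gplus :: "'a \<Rightarrow> 'a \<Rightarrow> 'a"
    and gzero :: 'a
    and gminus :: "'a \<Rightarrow> 'a"
    and gyr :: "'a \<Rightarrow> 'a \<Rightarrow> 'a \<Rightarrow> 'a"
    and N :: "'a set"
  assumes "productive_Lindelof_class \<L>"
    and "T \<in> \<L>"
    and "strongly_topological_gyrogroup T gplus gzero gminus gyr"
    and "strong_subgyrogroup (topspace T) gplus gyr N"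
    and "closedin T N"
    and "locally_compact_space (coset_space T gplus N)"
  shows "(weight (coset_space T gplus N), continuum) \<in> ordLeq \<longleftrightarrow>
         separable_space (coset_space T gplus N)"
proof
  interpret strongly_topological_gyrogroup T gplus gzero gminus gyr
    by (rule assms(3))
  \<comment> \<open>Membership in the class \<open>\<L>\<close> supplies the Lindelof property of
    \<open>T\<close>.\<close>
  interpret Lindelof_coset_space T gplus gzero gminus gyr N
    using assms strong_sub_if_strong_subgyrogroup by unfold_locales (auto simp: productive_Lindelof_class_def)
  show "separable_space (coset_space T gplus N)"
    if "(weight (coset_space T gplus N), continuum) \<in> ordLeq"
    using that by (rule separable_if_weight_le_continuum)
  show "(weight (coset_space T gplus N), continuum) \<in> ordLeq"
    if "separable_space (coset_space T gplus N)"
    using regular_coset_space that by (rule weight_le_continuum_if_regular_separable)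
qed

end
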